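(* Let $F/K(x)$ be a Kummer extension given by $y^m=\prod_{i=1}^r(x-\alpha_i)^{\lambda_i}$ with $0<\lambda_i<m$. Fix $\alpha_0\in K\setminus\{\alpha_1,\dots,\alpha_r\}$ and set $\alpha_{r+1}:=\infty$, $\lambda_0:=0$, $\lambda_{r+1}:=-\sum_{i=0}^r\lambda_i$. For $u\in\{0,\dots,r+1\}$ let $P_u$ be the place of $K(x)$ corresponding to $\alpha_u\in K\cup\{\infty\}$ (zero of $x-\alpha_u$, resp. pole of $x$), and let $D_u=\sum_{Q\mid P_u}Q$ be the sum of all places of $F$ lying over $P_u$. Put $m_u=m/\gcd(m,\lambda_u)$ (with $\gcd(m,0)=m$ and $\gcd$ taken of absolute values), and let $t_u\in\{0,\dots,m_u-1\}$ be the unique element with $s+\frac{\lambda_u}{\gcd(m,\lambda_u)}t_u\equiv 0\pmod{m_u}$. Then for every integer $s\ge1$, $\ell(sD_u)-\ell((s-1)D_u)$ equals the number of $j\in\{0,\dots,\gcd(m,\lambda_u)-1\}$ such that $$\sum_{i=0}^r\left\{\frac{(t_u+jm_u)\lambda_i}{m}\right\}\le 1+\left\lfloor\frac{s-1}{m_u}\right\rfloor .$$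
   Context: $K$ is an algebraically closed field of characteristic $p\ge0$. A Kummer extension $F/K(x)$ is $F=K(x,y)$ with $y^m=f(x)=\prod_{i=1}^r(x-\alpha_i)^{\lambda_i}$, where $m\ge2$, $p\nmid m$, $0<\lambda_i<m$, the $\alpha_i\in K$ are pairwise distinct, and $f$ is not a $d$-th power in $K(x)$ for any divisor $d>1$ of $m$. For a divisor $D$ of $F$, $\ell(D)=\dim_K\{z\in F:(z)\ge -D\}\cup\{0\}$. $\{x\}=x-\lfloor x\rfloor$ is the fractional part. *)

theory Defs
  imports "HOL-Computational_Algebra.Polynomial" Complex_Main
begin

definition alg_closed :: "'k::field itself \<Rightarrow> bool" where
  "alg_closed _ \<longleftrightarrow> (\<forall>p::'k poly. degree p > 0 \<longrightarrow> (\<exists>z. poly p z = 0))"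

definition field_hom :: "('k::field \<Rightarrow> 'f::field) \<Rightarrow> bool" where
  "field_hom \<iota> \<longleftrightarrow> \<iota> 0 = 0 \<and> \<iota> 1 = 1 \<and> (\<forall>a b. \<iota> (a + b) = \<iota> a + \<iota> b) \<and> (\<forall>a b. \<iota> (a * b) = \<iota> a * \<iota> b)"

definition transcendental_over :: "('k::field \<Rightarrow> 'f::field) \<Rightarrow> 'f \<Rightarrow> bool" where
  "transcendental_over \<iota> x \<longleftrightarrow> (\<forall>p::'k poly. p \<noteq> 0 \<longrightarrow> poly (map_poly \<iota> p) x \<noteq> 0)"

definition generated_by :: "('k::field \<Rightarrow> 'f::field) \<Rightarrow> 'f \<Rightarrow> 'f \<Rightarrow> bool" where
  "generated_by \<iota> x y \<longleftrightarrow>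
     (\<forall>S. range \<iota> \<subseteq> S \<longrightarrow> x \<in> S \<longrightarrow> y \<in> S \<longrightarrow>
          (\<forall>a\<in>S. \<forall>b\<in>S. a + b \<in> S \<and> a * b \<in> S \<and> - a \<in> S \<and> inverse a \<in> S) \<longrightarrow> S = UNIV)"

text \<open>Places of F/K, identified with their normalized discrete valuations
  F^* \<rightarrow> \<int> that are trivial on K (the value at 0 is fixed to 0 as a junk value,
  so that places and such functions correspond bijectively).\<close>
definition is_place :: "('k::field \<Rightarrow> 'f::field) \<Rightarrow> ('f \<Rightarrow> int) \<Rightarrow> bool" where
  "is_place \<iota> v \<longleftrightarrow>
     v 0 = 0 \<and>
     (\<forall>a b. a \<noteq> 0 \<longrightarrow> b \<noteq> 0 \<longrightarrow> v (a * b) = v a + v b) \<and>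
     (\<forall>a b. a \<noteq> 0 \<longrightarrow> b \<noteq> 0 \<longrightarrow> a + b \<noteq> 0 \<longrightarrow> v (a + b) \<ge> min (v a) (v b)) \<and>
     (\<forall>c. c \<noteq> 0 \<longrightarrow> v (\<iota> c) = 0) \<and>
     (\<exists>t. t \<noteq> 0 \<and> v t = 1)"

text \<open>The place v of F lies over the place of K(x) given by a point of
  K \<union> {\<infinity>} (Some a = zero of x - a, None = pole of x).\<close>
definition lies_over :: "('k::field \<Rightarrow> 'f::field) \<Rightarrow> 'f \<Rightarrow> ('f \<Rightarrow> int) \<Rightarrow> 'k option \<Rightarrow> bool" where
  "lies_over \<iota> x v P = (case P of Some a \<Rightarrow> v (x - \<iota> a) > 0 | None \<Rightarrow> v x < 0)"

definition RR_space :: "('k::field \<Rightarrow> 'f::field) \<Rightarrow> 'f \<Rightarrow> 'k option \<Rightarrow> int \<Rightarrow> 'f set" where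
  "RR_space \<iota> x P s = {z. z = 0 \<or>
      (\<forall>v. is_place \<iota> v \<longrightarrow> v z \<ge> (if lies_over \<iota> x v P then - s else 0))}"

definition ell :: "('k::field \<Rightarrow> 'f::field) \<Rightarrow> 'f \<Rightarrow> 'k option \<Rightarrow> int \<Rightarrow> nat" where
  "ell \<iota> x P s = vector_space.dim (\<lambda>c z. \<iota> c * z) (RR_space \<iota> x P s)"

definition lam_ext :: "(nat \<Rightarrow> nat) \<Rightarrow> nat \<Rightarrow> nat \<Rightarrow> int" where
  "lam_ext lam r i = (if i = 0 then 0 else if i \<le> r then int (lam i)
                      else - (\<Sum>k=1..r. int (lam k)))"

definition pt_ext :: "(nat \<Rightarrow> 'k) \<Rightarrow> 'k \<Rightarrow> nat \<Rightarrow> nat \<Rightarrow> 'k option" where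
  "pt_ext \<alpha> \<alpha>0 r u = (if u = 0 then Some \<alpha>0 else if u \<le> r then Some (\<alpha> u) else None)"

definition m_u :: "nat \<Rightarrow> int \<Rightarrow> int" where
  "m_u m l = int m div gcd (int m) l"

definition t_u :: "nat \<Rightarrow> int \<Rightarrow> int \<Rightarrow> int" where
  "t_u m l s = (THE t. 0 \<le> t \<and> t < m_u m l \<and>
                  (s + (l div gcd (int m) l) * t) mod m_u m l = 0)"

end

theory Submission
  imports Defs "HOL-Computational_Algebra.Formal_Laurent_Series" "HOL-Computational_Algebra.Polynomial_FPS"
begin

text \<open>
  The group of \<open>m\<close>-th roots of unity acts on \<open>F\<close> by \<open>y \<mapsto> \<zeta> y\<close> and permutes the places over
  each point, so a Riemann-Roch space supported on a full fibre is the direct sum of its intersections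
  with the lines \<open>K(x) y ^ k\<close>. On such a line, the conditions at the places over a point \<open>P\<close> amount
  to one lower bound, by the floor of a rational number, on the order at \<open>P\<close> of the coefficient:
  places over \<open>P\<close> exist because \<open>F\<close> embeds into Laurent series over \<open>K\<close>, and their ramification
  index is \<open>m / gcd(m, \<lambda>)\<close> by a Hensel approximation. Each summand is thus a space of polynomials of
  bounded degree times a fixed function, and replacing \<open>s - 1\<close> by \<open>s\<close> raises exactly those degree
  bounds with \<open>k \<equiv> t\<^sub>u\<close> modulo \<open>m\<^sub>u\<close>, each by one.
\<close>

section \<open>Homomorphisms, roots of unity and roots of power series\<close>

text \<open>Origin of \<open>floor_exp\<close>: at a place over P of ramification index e = m / g,
  where g = gcd(m, \<lambda>), the element a y^k has value e (ord a + k \<lambda> / m). The bound -s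
  reads ord a >= -(k \<lambda> + s g) / m, and integrality of the order brings in the floor. The
  numbers \<lambda> form the divisor of f and add up to 0, which turns the sum of floors into the
  fractional parts of the statement. The obstacle is that a place is just a normalized valuation:
  nothing is known in advance about its residue field or its ramification. Necessity of the floor
  conditions takes one place over each point, sufficiency takes the exact index of every place.
  Coprimality gives one divisibility for the index; normalization gives the other only when all
  values on F are controlled, which is why y must be compared with elements of K(x) to arbitrary
  precision. The hypothesis on d-th powers enters only through the linear independence of 1, y, ...,
  y^(m-1) over K(x).\<close>

locale unital_hom =
  fixes h :: "'a::comm_ring_1 \<Rightarrow> 'b::comm_ring_1"
  assumes hom_0: "h 0 = 0" and hom_1: "h 1 = 1"
    and hom_add: "h (a + b) = h a + h b" and hom_mult: "h (a * b) = h a * h b"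
begin

lemma hom_minus: "h (- a) = - h a"
proof -
  have "h (- a) + h a = 0" using hom_add[of "- a" a] by (simp add: hom_0)
  thus ?thesis by (simp add: eq_neg_iff_add_eq_0)
qed

lemma hom_diff: "h (a - b) = h a - h b"
  using hom_add[of a "- b"] by (simp add: hom_minus)

lemma hom_power: "h (a ^ n) = h a ^ n"
  by (induction n) (simp_all add: hom_1 hom_mult)

lemma hom_sum: "h (sum f A) = (\<Sum>i\<in>A. h (f i))"
  by (induction A rule: infinite_finite_induct) (simp_all add: hom_0 hom_add)

lemma hom_prod: "h (prod f A) = (\<Prod>i\<in>A. h (f i))"
  by (induction A rule: infinite_finite_induct) (simp_all add: hom_1 hom_mult)

end

lemma unital_hom_field_hom: "field_hom h \<longleftrightarrow> unital_hom h"
  unfolding field_hom_def unital_hom_def by blast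

locale unital_field_hom = unital_hom h for h :: "'a::field \<Rightarrow> 'b::field"
begin

lemma hom_eq_0_iff: "h a = 0 \<longleftrightarrow> a = 0"
proof
  assume "h a = 0"
  show "a = 0"
  proof (rule ccontr)
    assume "a \<noteq> 0"
    hence "h a * h (inverse a) = 1" using hom_mult[of a "inverse a"] hom_1 by simp
    with \<open>h a = 0\<close> show False by simp
  qed
qed (simp add: hom_0)

lemma hom_inverse: "h (inverse a) = inverse (h a)"
proof (cases "a = 0")
  case False
  have "h (inverse a) * h a = 1" using hom_mult[of "inverse a" a] hom_1 False by simp
  thus ?thesis by (metis inverse_unique mult.commute)
qed (simp add: hom_0)

end

section \<open>Evaluation of polynomials through a homomorphism\<close>

definition hom_eval :: "('a::comm_ring_1 \<Rightarrow> 'b::comm_ring_1) \<Rightarrow> 'b \<Rightarrow> 'a poly \<Rightarrow> 'b" where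
  "hom_eval h b p = poly (map_poly h p) b"

context unital_hom
begin

lemma hom_eval_0 [simp]: "hom_eval h b 0 = 0"
  by (simp add: hom_eval_def)

lemma hom_eval_pCons [simp]: "hom_eval h b (pCons a p) = h a + b * hom_eval h b p"
  by (cases "a = 0 \<and> p = 0") (auto simp: hom_eval_def map_poly_pCons hom_0)

lemma hom_eval_1 [simp]: "hom_eval h b 1 = 1"
  by (simp add: one_pCons hom_1)

lemma hom_eval_add: "hom_eval h b (p + q) = hom_eval h b p + hom_eval h b q"
  by (induction p q rule: poly_induct2) (simp_all add: hom_add algebra_simps)

lemma hom_eval_smult: "hom_eval h b (smult c p) = h c * hom_eval h b p"
  by (induction p) (simp_all add: hom_mult algebra_simps)

lemma hom_eval_mult: "hom_eval h b (p * q) = hom_eval h b p * hom_eval h b q"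
  by (induction p) (simp_all add: hom_eval_add hom_eval_smult hom_0 algebra_simps)

lemma hom_eval_unital_hom: "unital_hom (hom_eval h b)"
  by unfold_locales (simp_all add: hom_eval_add hom_eval_mult)

lemma hom_eval_monom: "hom_eval h b (monom c n) = h c * b ^ n"
  by (induction n) (simp_all add: monom_Suc monom_0 hom_0 algebra_simps)

lemma map_poly_mult_hom: "map_poly h (p * q) = map_poly h p * map_poly h q"
  by (rule poly_eqI) (simp add: coeff_map_poly hom_0 coeff_mult hom_sum hom_mult)

lemma hom_eval_as_sum:
  assumes "degree p < n"
  shows "hom_eval h b p = (\<Sum>k<n. h (coeff p k) * b ^ k)"
proof -
  interpret E: unital_hom "hom_eval h b" by (rule hom_eval_unital_hom)
  have "p = (\<Sum>k\<le>n - 1. monom (coeff p k) k)"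
    using assms by (intro poly_as_sum_of_monoms'[symmetric]) simp
  hence "hom_eval h b p = (\<Sum>k\<le>n - 1. h (coeff p k) * b ^ k)"
    by (metis (no_types, lifting) E.hom_sum hom_eval_monom sum.cong)
  also have "{..n - 1} = {..<n}" using assms by auto
  finally show ?thesis .
qed

end

section \<open>Roots of unity over an algebraically closed field\<close>

lemma simple_roots_imp_prod:
  fixes p :: "'k::field poly"
  assumes ac: "alg_closed TYPE('k)" and "p \<noteq> 0"
    and "\<And>z. poly p z = 0 \<Longrightarrow> poly (pderiv p) z \<noteq> 0"
  shows "p = smult (lead_coeff p) (\<Prod>z | poly p z = 0. [:- z, 1:])"
  using assms(2,3)
proof (induction "degree p" arbitrary: p)
  case 0
  then obtain c where "p = [:c:]" by (metis degree_eq_zeroE)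
  with 0 show ?case by simp
next
  case (Suc n)
  then obtain z where z: "poly p z = 0" using ac unfolding alg_closed_def by (metis zero_less_Suc)
  then obtain q where q: "p = [:- z, 1:] * q" by (auto simp: poly_eq_0_iff_dvd elim: dvdE)
  with Suc.prems have q0: "q \<noteq> 0" by auto
  have deg: "n = degree q" using Suc.hyps(2) q q0 by (simp add: degree_mult_eq del: mult_pCons_left)
  have pd: "poly (pderiv p) w = (w - z) * poly (pderiv q) w + poly q w" for w
    unfolding q pderiv_mult by (simp add: pderiv_pCons algebra_simps del: mult_pCons_left mult_pCons_right)
  \<comment> \<open>The derivative of p at z is q(z), so simplicity of the root keeps z out of the
    roots of q. This is why a product over the root set, without multiplicities, suffices.\<close>
  have zq: "poly q z \<noteq> 0" using Suc.prems(2)[OF z] pd[of z] by auto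
  have "poly (pderiv q) w \<noteq> 0" if "poly q w = 0" for w
    using Suc.prems(2)[of w] that pd[of w] q by auto
  from Suc.hyps(1)[OF deg q0 this]
  have IH: "q = smult (lead_coeff q) (\<Prod>z | poly q z = 0. [:- z, 1:])" .
  have roots: "{w. poly p w = 0} = insert z {w. poly q w = 0}" using q by auto
  have fin: "finite {w. poly q w = 0}" by (rule poly_roots_finite[OF q0])
  have lc: "lead_coeff p = lead_coeff q" by (simp add: q lead_coeff_mult del: mult_pCons_left)
  have "(\<Prod>z | poly p z = 0. [:- z, 1:]) = [:- z, 1:] * (\<Prod>z | poly q z = 0. [:- z, 1:])"
    unfolding roots using fin zq by (subst prod.insert) auto
  hence "smult (lead_coeff p) (\<Prod>z | poly p z = 0. [:- z, 1:])
       = [:- z, 1:] * smult (lead_coeff q) (\<Prod>z | poly q z = 0. [:- z, 1:])"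
    by (simp only: lc mult_smult_right)
  also have "\<dots> = p" using IH q by metis
  finally show ?case by simp
qed

definition roots_unity :: "nat \<Rightarrow> 'k::field set" where
  "roots_unity n = {z. z ^ n = 1}"

text \<open>The derivative n z^(n-1) vanishes at no root because n is non-zero in K, so all roots
  are simple; comparing degrees gives the count.\<close>

lemma roots_unity_factorization:
  assumes ac: "alg_closed TYPE('k)" and n: "of_nat n \<noteq> (0::'k::field)"
  shows "monom 1 n - 1 = (\<Prod>z\<in>roots_unity n. [:- z, 1:] :: 'k poly)"
    and "card (roots_unity n :: 'k set) = n" and "finite (roots_unity n :: 'k set)"
proof -
  let ?p = "monom 1 n - 1 :: 'k poly"
  have n0: "n > 0" using n by (cases n) auto
  have deg: "degree ?p = n"
    using n0 by (subst diff_conv_add_uminus, subst degree_add_eq_left) (simp_all add: degree_monom_eq)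
  have p0: "?p \<noteq> 0" using deg n0 by auto
  have lc: "lead_coeff ?p = 1" using n0 by (simp add: deg coeff_diff)
  have root: "poly ?p z = 0 \<longleftrightarrow> z ^ n = 1" for z by (simp add: poly_monom)
  have "poly (pderiv ?p) z \<noteq> 0" if "poly ?p z = 0" for z
  proof -
    have "z \<noteq> 0" using that root n0 by (auto simp: zero_power)
    thus ?thesis using n by (simp add: pderiv_diff pderiv_monom poly_monom)
  qed
  from simple_roots_imp_prod[OF ac p0 this]
  have eq: "?p = (\<Prod>z\<in>roots_unity n. [:- z, 1:])"
    unfolding lc root roots_unity_def by simp
  thus "?p = (\<Prod>z\<in>roots_unity n. [:- z, 1:])" .
  show "finite (roots_unity n :: 'k set)"
    using poly_roots_finite[OF p0] unfolding root roots_unity_def .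
  have "degree (\<Prod>z\<in>roots_unity n. [:- z, 1:] :: 'k poly) = (\<Sum>z\<in>(roots_unity n::'k set). 1)"
    by (subst degree_prod_sum_eq) auto
  thus "card (roots_unity n :: 'k set) = n" using eq deg by simp
qed

text \<open>Multiplication by a root z0 permutes the roots, so the sum is unchanged by the factor
  z0^d. This orthogonality relation later projects an element of F onto a single power of y.\<close>

lemma sum_powers_roots_unity:
  assumes ac: "alg_closed TYPE('k)" and m: "of_nat m \<noteq> (0::'k::field)"
  shows "(\<Sum>z\<in>roots_unity m. z ^ d :: 'k) = (if m dvd d then of_nat m else 0)"
proof (cases "m dvd d")
  case True
  then obtain c where "d = m * c" by blast
  hence "(\<Sum>z\<in>roots_unity m. z ^ d :: 'k) = (\<Sum>z\<in>(roots_unity m :: 'k set). 1)"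
    by (intro sum.cong) (auto simp: roots_unity_def power_mult)
  thus ?thesis using True roots_unity_factorization(2)[OF ac m] by simp
next
  case False
  have m0: "m > 0" using m by (cases m) auto
  have zd: "z ^ d = z ^ (d mod m)" if "z \<in> roots_unity m" for z :: 'k
  proof -
    have "z ^ d = z ^ (m * (d div m) + d mod m)" by simp
    also have "\<dots> = (z ^ m) ^ (d div m) * z ^ (d mod m)" by (simp only: power_add power_mult)
    finally show ?thesis using that by (simp add: roots_unity_def)
  qed
  have dm: "d mod m > 0" using False by (simp add: mod_greater_zero_iff_not_dvd)
  \<comment> \<open>If every root satisfied z^d = 1, then X^(d mod m) - 1, non-zero and of degree
    below m, would have m roots.\<close>
  have "\<exists>z0::'k. z0 \<in> roots_unity m \<and> z0 ^ d \<noteq> 1"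
  proof (rule ccontr)
    assume "\<not> ?thesis"
    hence sub: "roots_unity m \<subseteq> {z::'k. poly (monom 1 (d mod m) - 1) z = 0}"
      using zd by (auto simp: poly_monom)
    have "coeff (monom 1 (d mod m) - 1 :: 'k poly) (d mod m) = 1"
      using dm by (simp add: coeff_diff)
    hence ne: "(monom 1 (d mod m) - 1 :: 'k poly) \<noteq> 0" by (metis coeff_0 zero_neq_one)
    have "m \<le> card {z::'k. poly (monom 1 (d mod m) - 1) z = 0}"
      using card_mono[OF poly_roots_finite[OF ne] sub] roots_unity_factorization(2)[OF ac m] by simp
    also have "\<dots> \<le> degree (monom 1 (d mod m) - 1 :: 'k poly)"
      by (rule card_poly_roots_bound[OF ne])
    also have "\<dots> \<le> d mod m"
      by (intro degree_diff_le) (auto simp: degree_monom_le)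
    also have "\<dots> < m" using m0 by simp
    finally show False by simp
  qed
  then obtain z0 :: 'k where z0: "z0 ^ m = 1" "z0 ^ d \<noteq> 1" by (auto simp: roots_unity_def)
  have z00: "z0 \<noteq> 0" using z0 m0 by (auto simp: zero_power)
  have "bij_betw (\<lambda>z. z0 * z) (roots_unity m) (roots_unity m)"
    by (rule bij_betw_byWitness[where f' = "\<lambda>z. inverse z0 * z"])
       (use z0 z00 in \<open>auto simp: roots_unity_def power_mult_distrib power_inverse\<close>)
  hence "(\<Sum>z\<in>roots_unity m. (z0 * z) ^ d) = (\<Sum>z\<in>roots_unity m. z ^ d)"
    by (rule sum.reindex_bij_betw)
  hence "z0 ^ d * (\<Sum>z\<in>roots_unity m. z ^ d) = (\<Sum>z\<in>roots_unity m. z ^ d)"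
    by (simp add: power_mult_distrib sum_distrib_left)
  hence "(z0 ^ d - 1) * (\<Sum>z\<in>roots_unity m. z ^ d) = 0" by (simp add: algebra_simps)
  thus ?thesis using z0 False by simp
qed

text \<open>Homogenizes the factorization of X^n - 1 by substituting w/s. The target is a
  commutative ring so that the result also applies in F[Y], with the constant \<open>[:y:]\<close>
  as the unit s.\<close>

lemma power_diff_factorization_unit:
  fixes h :: "'k::field \<Rightarrow> 'b::comm_ring_1"
  assumes "unital_hom h" and ac: "alg_closed TYPE('k)" and n: "of_nat n \<noteq> (0::'k)" and s: "s * s' = 1"
  shows "w ^ n - s ^ n = (\<Prod>z\<in>roots_unity n. w - h z * s)"
proof -
  interpret unital_hom h by fact
  interpret E: unital_hom "hom_eval h (w * s')" by (rule hom_eval_unital_hom)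
  have "hom_eval h (w * s') (monom 1 n - 1) = (\<Prod>z\<in>roots_unity n. hom_eval h (w * s') [:- z, 1:])"
    by (subst roots_unity_factorization(1)[OF ac n]) (rule E.hom_prod)
  hence "(w * s') ^ n - 1 = (\<Prod>z\<in>roots_unity n. w * s' - h z)"
    by (simp add: E.hom_diff hom_eval_monom hom_1 hom_minus hom_0)
  hence "((w * s') ^ n - 1) * s ^ n = (\<Prod>z\<in>roots_unity n. w * s' - h z) * s ^ card (roots_unity n :: 'k set)"
    by (simp only: roots_unity_factorization(2)[OF ac n])
  moreover have "((w * s') ^ n - 1) * s ^ n = w ^ n * (s * s') ^ n - s ^ n"
    by (simp add: power_mult_distrib algebra_simps)
  ultimately have "w ^ n - s ^ n = (\<Prod>z\<in>roots_unity n. w * s' - h z) * (\<Prod>z\<in>(roots_unity n :: 'k set). s)"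
    by (simp add: s)
  also have "\<dots> = (\<Prod>z\<in>roots_unity n. w - h z * s)"
  proof (subst prod.distrib[symmetric], rule prod.cong[OF refl])
    fix z
    have "(w * s' - h z) * s = w * (s * s') - h z * s" by (simp add: algebra_simps)
    thus "(w * s' - h z) * s = w - h z * s" by (simp add: s)
  qed
  finally show ?thesis .
qed

lemma (in unital_field_hom) power_diff_factorization:
  assumes ac: "alg_closed TYPE('a)" and n: "of_nat n \<noteq> (0::'a)"
  shows "w ^ n - s ^ n = (\<Prod>z\<in>roots_unity n. w - h z * s)"
proof (cases "s = 0")
  case True
  have "n > 0" using n by (cases n) auto
  thus ?thesis using True roots_unity_factorization(2)[OF ac n] by (simp add: zero_power)
next
  case False
  hence "s * inverse s = 1" by simp
  thus ?thesis by (rule power_diff_factorization_unit[OF unital_hom_axioms ac n])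
qed

section \<open>Divisibility of polynomials and factors of split polynomials\<close>

lemma dvd_of_order_le:
  fixes p q :: "'k::field poly"
  assumes ac: "alg_closed TYPE('k)" and "p \<noteq> 0" "q \<noteq> 0" "\<And>b. order b q \<le> order b p"
  shows "q dvd p"
  using assms(2-)
proof (induction "degree q" arbitrary: p q)
  case 0
  then obtain c where "q = [:c:]" by (metis degree_eq_zeroE)
  with 0 show ?case by (metis is_unit_const_poly_iff dvd_trans one_dvd dvd_field_iff pCons_0_0)
next
  case (Suc n)
  then obtain z where z: "poly q z = 0" using ac unfolding alg_closed_def by (metis zero_less_Suc)
  then obtain q' where q': "q = [:- z, 1:] * q'" by (auto simp: poly_eq_0_iff_dvd elim: dvdE)
  with Suc.prems have q0: "q' \<noteq> 0" by auto
  have "order z q \<noteq> 0" using z Suc.prems by (simp add: order_root)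
  hence "poly p z = 0" using Suc.prems(3)[of z] Suc.prems(1) by (simp add: order_root)
  then obtain p' where p': "p = [:- z, 1:] * p'" by (auto simp: poly_eq_0_iff_dvd elim: dvdE)
  with Suc.prems have p0: "p' \<noteq> 0" by auto
  have deg: "n = degree q'" using Suc.hyps(2) q' q0 by (simp add: degree_mult_eq del: mult_pCons_left)
  have "order b q' \<le> order b p'" for b
    using Suc.prems(3)[of b] Suc.prems(1,2) unfolding p' q' by (simp add: order_mult del: mult_pCons_left)
  from Suc.hyps(1)[OF deg p0 q0 this] show ?case unfolding p' q' by (rule mult_dvd_mono[OF dvd_refl])
qed

text \<open>Peels off one linear factor at a time: either q vanishes at its root and the factor is
  cancelled from q, or the cofactor vanishes there. It gives the shape over F of a factor of the
  equation of y.\<close>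

lemma dvd_prod_linear_imp:
  fixes q :: "'f::field poly"
  assumes "finite A" "q dvd (\<Prod>c\<in>A. [:- g c, 1:])"
  shows "\<exists>B\<subseteq>A. q = smult (lead_coeff q) (\<Prod>c\<in>B. [:- g c, 1:])"
  using assms
proof (induction A arbitrary: q rule: finite_induct)
  case empty
  hence "is_unit q" by simp
  then obtain c where "q = [:c:]" by (metis is_unit_poly_iff)
  thus ?case by simp
next
  case (insert a A)
  let ?l = "[:- g a, 1:]" and ?R = "\<Prod>c\<in>A. [:- g c, 1:]"
  from insert.prems insert.hyps obtain s where s: "?l * ?R = q * s"
    unfolding dvd_def prod.insert[OF insert.hyps] by blast
  show ?case
  proof (cases "poly q (g a) = 0")
    case True
    then obtain q' where q': "q = ?l * q'" by (auto simp: poly_eq_0_iff_dvd elim: dvdE)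
    have "?l * ?R = ?l * (q' * s)" using s unfolding q' by (simp only: mult.assoc)
    hence "?R = q' * s" by (subst (asm) mult_left_cancel) auto
    hence "q' dvd ?R" by simp
    from insert.IH[OF this] obtain B where B: "B \<subseteq> A" "q' = smult (lead_coeff q') (\<Prod>c\<in>B. [:- g c, 1:])"
      by blast
    have "lead_coeff q = lead_coeff q'" unfolding q' by (simp add: lead_coeff_mult del: mult_pCons_left)
    moreover have "(\<Prod>c\<in>insert a B. [:- g c, 1:]) = ?l * (\<Prod>c\<in>B. [:- g c, 1:])"
      using B insert.hyps by (subst prod.insert) (auto intro: finite_subset)
    ultimately have "smult (lead_coeff q) (\<Prod>c\<in>insert a B. [:- g c, 1:]) = ?l * smult (lead_coeff q') (\<Prod>c\<in>B. [:- g c, 1:])"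
      by (simp only: mult_smult_right)
    also have "\<dots> = q" using B q' by metis
    finally show ?thesis using B by (intro exI[of _ "insert a B"]) auto
  next
    case False
    have "poly (q * s) (g a) = 0" unfolding s[symmetric] by simp
    hence "poly s (g a) = 0" using False by simp
    then obtain s' where s': "s = ?l * s'" by (auto simp: poly_eq_0_iff_dvd elim: dvdE)
    have "?l * ?R = ?l * (q * s')" using s unfolding s' by (simp only: mult_ac)
    hence "?R = q * s'" by (subst (asm) mult_left_cancel) auto
    hence "q dvd ?R" by simp
    from insert.IH[OF this] show ?thesis by blast
  qed
qed

section \<open>Roots of power series and Laurent series by successive approximation\<close>

lemma fps_power_cong_upto:
  assumes "\<And>i. i \<le> n \<Longrightarrow> A $ i = B $ i" "i \<le> n"
  shows "((A::'a::comm_ring_1 fps) ^ k) $ i = (B ^ k) $ i"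
  using assms(2)
proof (induction k arbitrary: i)
  case 0
  show ?case by simp
next
  case (Suc k)
  have "(A ^ Suc k) $ i = (\<Sum>j=0..i. A $ j * (A ^ k) $ (i - j))" unfolding power_Suc by (rule fps_mult_nth)
  also have "\<dots> = (\<Sum>j=0..i. B $ j * (B ^ k) $ (i - j))"
  proof (rule sum.cong[OF refl])
    fix j assume "j \<in> {0..i}"
    hence j: "j \<le> n" "i - j \<le> n" using Suc.prems by auto
    show "A $ j * (A ^ k) $ (i - j) = B $ j * (B ^ k) $ (i - j)"
      unfolding assms(1)[OF j(1)] Suc.IH[OF j(2)] by (rule refl)
  qed
  also have "\<dots> = (B ^ Suc k) $ i" unfolding power_Suc by (rule fps_mult_nth[symmetric])
  finally show ?case .
qed

lemma power_add_expansion2: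
  fixes a b :: "'a::comm_ring_1"
  shows "\<exists>r. (a + b) ^ k = a ^ k + of_nat k * a ^ (k - 1) * b + b ^ 2 * r"
proof (induction k)
  case (Suc k)
  then obtain r where r: "(a + b) ^ k = a ^ k + of_nat k * a ^ (k - 1) * b + b ^ 2 * r" by blast
  have "of_nat k * a ^ (k - 1) * a = of_nat k * a ^ k" by (cases k) (simp_all add: mult.commute)
  hence "(a + b) ^ Suc k = a ^ Suc k + of_nat (Suc k) * a ^ (Suc k - 1) * b
           + b ^ 2 * (a * r + of_nat k * a ^ (k - 1) + b * r)"
    unfolding power_Suc r by (simp add: algebra_simps power2_eq_square)
  thus ?case by blast
qed (auto intro: exI[of _ 0])

text \<open>The Newton step: the quadratic remainder starts in degree 2n > n, so the change in
  degree n is linear in c and lower degrees stay as they are.\<close>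

lemma fps_power_perturb_nth:
  fixes A :: "'a::comm_ring_1 fps"
  assumes "n \<ge> 1" "i \<le> n"
  shows "((A + fps_const c * fps_X ^ n) ^ k) $ i
           = (A ^ k) $ i + (if i = n then of_nat k * (A $ 0) ^ (k - 1) * c else 0)"
proof -
  obtain R where R: "(A + fps_const c * fps_X ^ n) ^ k = A ^ k
      + of_nat k * A ^ (k - 1) * (fps_const c * fps_X ^ n) + (fps_const c * fps_X ^ n) ^ 2 * R"
    using power_add_expansion2 by blast
  have 1: "of_nat k * A ^ (k - 1) * (fps_const c * fps_X ^ n)
      = fps_X ^ n * (fps_const (of_nat k * c) * A ^ (k - 1))"
    by (simp add: fps_of_nat[symmetric] mult_ac flip: fps_const_mult)
  have 2: "(fps_const c * fps_X ^ n) ^ 2 * R = fps_X ^ (2 * n) * (fps_const (c ^ 2) * R)"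
    by (simp add: power_mult_distrib fps_const_power power_mult[symmetric] mult_ac)
  have "i < 2 * n" using assms by simp
  hence "((fps_const c * fps_X ^ n) ^ 2 * R) $ i = 0"
    unfolding 2 fps_X_power_mult_nth by simp
  moreover have "(of_nat k * A ^ (k - 1) * (fps_const c * fps_X ^ n)) $ i
      = (if i = n then of_nat k * (A $ 0) ^ (k - 1) * c else 0)"
    unfolding 1 fps_X_power_mult_nth using assms(2) by (auto simp: fps_power_zeroth mult_ac)
  ultimately show ?thesis unfolding R by simp
qed

text \<open>Coefficientwise lifting: each new coefficient solves a linear equation with slope k
  w^(k-1), which is non-zero by assumption.\<close>

lemma fps_root_exists:
  fixes H :: "'a::field fps"
  assumes k: "of_nat k \<noteq> (0::'a)" and w: "w ^ k = H $ 0" "w \<noteq> 0"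
  shows "\<exists>S. S ^ k = H \<and> S $ 0 = w"
proof -
  define P where "P n T \<longleftrightarrow> T $ 0 = w \<and> (\<forall>i\<le>n. (T ^ k) $ i = H $ i)" for n and T :: "'a fps"
  define Q where "Q n T T' \<longleftrightarrow> (\<forall>i\<le>n. T' $ i = T $ i)" for n :: nat and T T' :: "'a fps"
  have "\<exists>T. \<forall>n. P n (T n) \<and> Q n (T n) (T (Suc n))"
  proof (rule dependent_nat_choice)
    show "\<exists>T. P 0 T" using w by (intro exI[of _ "fps_const w"]) (simp add: P_def fps_power_zeroth)
  next
    fix T n assume T: "P n T"
    define c where "c = (H $ Suc n - (T ^ k) $ Suc n) / (of_nat k * w ^ (k - 1))"
    define T' where "T' = T + fps_const c * fps_X ^ Suc n"
    have Tw: "T $ 0 = w" using T by (simp add: P_def)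
    hence T0: "T' $ 0 = w" by (simp add: T'_def)
    have "(T' ^ k) $ i = H $ i" if "i \<le> Suc n" for i
    proof -
      have 1: "(T' ^ k) $ i = (T ^ k) $ i + (if i = Suc n then of_nat k * w ^ (k - 1) * c else 0)"
        unfolding T'_def Tw[symmetric] by (rule fps_power_perturb_nth) (use that in auto)
      have 2: "of_nat k * w ^ (k - 1) * c = H $ Suc n - (T ^ k) $ Suc n"
        using k w by (simp add: c_def)
      show ?thesis
      proof (cases "i = Suc n")
        case True thus ?thesis unfolding 1 2 by simp
      next
        case False
        hence "i \<le> n" using that by simp
        hence "(T ^ k) $ i = H $ i" using T unfolding P_def by blast
        thus ?thesis unfolding 1 using False by simp
      qed
    qed
    moreover have "T' $ i = T $ i" if "i \<le> n" for i
      using that by (simp add: T'_def fps_X_power_nth del: power_Suc)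
    ultimately show "\<exists>T'. P (Suc n) T' \<and> Q n T T'" using T0 by (intro exI[of _ T']) (simp add: P_def Q_def)
  qed
  then obtain T where T: "P n (T n)" "Q n (T n) (T (Suc n))" for n by blast
  \<comment> \<open>Each coefficient stops changing once it is fixed, so the diagonal is the limit
    of the approximants.\<close>
  define S where "S = Abs_fps (\<lambda>n. T n $ n)"
  have stable: "T n $ i = T i $ i" if "i \<le> n" for n i
    using that
  proof (induction n)
    case (Suc n)
    have "i = Suc n \<or> i \<le> n \<and> T (Suc n) $ i = T n $ i"
      using T(2)[of n] Suc.prems by (auto simp only: Q_def le_Suc_eq)
    thus ?case using Suc.IH by (elim disjE conjE) simp_all
  qed simp
  have "(S ^ k) $ n = H $ n" for n
  proof -
    have "(S ^ k) $ n = (T n ^ k) $ n"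
    proof (rule fps_power_cong_upto[of n])
      show "S $ i = T n $ i" if "i \<le> n" for i
        unfolding S_def using stable[OF that] by (metis fps_nth_Abs_fps)
    qed simp
    thus ?thesis using T(1)[of n] by (simp add: P_def)
  qed
  hence "S ^ k = H" by (intro fps_ext)
  moreover have "S $ 0 = w" using T(1)[of 0] by (simp add: S_def P_def)
  ultimately show ?thesis by blast
qed

lemma alg_closed_root_exists:
  assumes "alg_closed TYPE('k)" "n > 0"
  shows "\<exists>w::'k::field. w ^ n = c"
proof -
  have "degree (monom 1 n - [:c:] :: 'k poly) = n"
    using assms(2) by (subst diff_conv_add_uminus, subst degree_add_eq_left) (simp_all add: degree_monom_eq)
  then obtain z :: 'k where "poly (monom 1 n - [:c:]) z = 0"
    using assms unfolding alg_closed_def by metis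
  thus ?thesis by (auto simp: poly_monom)
qed

text \<open>Splits A into a power of the variable, whose exponent is divisible by m, and a power
  series with non-zero constant term.\<close>

lemma fls_root_exists:
  fixes A :: "'k::field fls"
  assumes ac: "alg_closed TYPE('k)" and m: "of_nat m \<noteq> (0::'k)"
    and A: "A \<noteq> 0" "int m dvd fls_subdegree A"
  shows "\<exists>\<eta>. \<eta> ^ m = A"
proof -
  have m0: "m > 0" using m by (cases m) auto
  obtain c where c: "fls_subdegree A = int m * c" using A(2) by blast
  let ?H = "fls_base_factor_to_fps A"
  obtain w where w: "w ^ m = ?H $ 0" using alg_closed_root_exists[OF ac m0] by blast
  have "w \<noteq> 0" using w fls_base_factor_to_fps_base[OF A(1)] m0 by (auto simp: zero_power)
  from fps_root_exists[OF m w this] obtain S where S: "S ^ m = ?H" by blast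
  have "(fls_X_intpow c * fps_to_fls S) ^ m = fls_X_intpow (int m * c) * fps_to_fls ?H"
    unfolding S[symmetric] by (simp add: power_mult_distrib fps_to_fls_power fls_X_intpow_power)
  also have "\<dots> = A"
    unfolding c[symmetric] fls_X_intpow_times_conv_shift
    by (rule fls_conv_base_factor_to_fps_shift_subdegree[symmetric])
  finally show ?thesis by blast
qed

section \<open>The field \<open>F\<close> over \<open>K(x)\<close>\<close>

locale kummer =
  fixes \<iota> :: "'k::field \<Rightarrow> 'f::field"
    and x y :: 'f and m r :: nat and \<alpha> :: "nat \<Rightarrow> 'k" and lam :: "nat \<Rightarrow> nat"
  assumes ac: "alg_closed TYPE('k)"
    and m_ge_2: "m \<ge> 2" and m_nz: "of_nat m \<noteq> (0::'k)"
    and inj_alpha: "inj_on \<alpha> {1..r}"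
    and not_power: "\<forall>d. d > 1 \<longrightarrow> d dvd m \<longrightarrow>
           \<not> (\<exists>p q :: 'k poly. q \<noteq> 0 \<and> (\<Prod>i=1..r. [:- \<alpha> i, 1:] ^ lam i) * q ^ d = p ^ d)"
    and field_hom_\<iota>: "field_hom \<iota>" and transc: "transcendental_over \<iota> x"
    and y_power: "y ^ m = (\<Prod>i=1..r. (x - \<iota> (\<alpha> i)) ^ lam i)"
    and generated: "generated_by \<iota> x y"
begin

sublocale \<iota>: unital_field_hom \<iota>
  using field_hom_\<iota> unfolding unital_hom_field_hom unital_field_hom_def .

definition f :: "'k poly" where "f = (\<Prod>i=1..r. [:- \<alpha> i, 1:] ^ lam i)"

abbreviation ev :: "'k poly \<Rightarrow> 'f" where "ev \<equiv> hom_eval \<iota> x"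

sublocale ev: unital_hom ev by (rule \<iota>.hom_eval_unital_hom)

abbreviation ev2 :: "'k poly poly \<Rightarrow> 'f" where "ev2 \<equiv> hom_eval ev y"

sublocale ev2: unital_hom ev2 by (rule ev.hom_eval_unital_hom)

lemma m_pos: "m > 0" using m_ge_2 by simp

lemma ev_eq_0_iff [simp]: "ev p = 0 \<longleftrightarrow> p = 0"
  using transc unfolding transcendental_over_def hom_eval_def by auto

lemma ev_inj: "ev p = ev q \<longleftrightarrow> p = q"
  using ev_eq_0_iff[of "p - q"] by (simp add: ev.hom_diff)

lemma ev_linear: "ev [:- a, 1:] = x - \<iota> a"
  by (simp add: \<iota>.hom_minus \<iota>.hom_1)

lemma x_minus_nz [simp]: "x - \<iota> a \<noteq> 0"
  using ev_eq_0_iff[of "[:- a, 1:]"] unfolding ev_linear by simp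

lemma x_nz [simp]: "x \<noteq> 0"
  using x_minus_nz[of 0] by (simp add: \<iota>.hom_0 del: x_minus_nz)

lemma f_nz: "f \<noteq> 0" by (simp add: f_def)

lemma ev_f: "ev f = y ^ m"
  unfolding f_def y_power ev.hom_prod ev.hom_power ev_linear ..

lemma y_nz [simp]: "y \<noteq> 0"
proof
  assume "y = 0"
  hence "ev f = 0" using m_pos by (simp add: ev_f)
  thus False using f_nz by simp
qed

text \<open>The equation of y over K[x]. Since it is monic, reducing modulo it creates no
  denominators.\<close>

definition G :: "'k poly poly" where "G = monom 1 m - [:f:]"

lemma ev2_G: "ev2 G = 0"
  unfolding G_def ev2.hom_diff by (simp add: ev.hom_eval_monom ev_f)

lemma degree_G: "degree G = m"
  unfolding G_def using m_pos
  by (subst diff_conv_add_uminus, subst degree_add_eq_left) (simp_all add: degree_monom_eq)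

lemma lead_coeff_G: "lead_coeff G = 1"
  unfolding degree_G using m_pos by (simp add: G_def coeff_diff coeff_pCons split: nat.split)

lemma G_nz: "G \<noteq> 0" using lead_coeff_G by auto

text \<open>With d = gcd(n, m), Bezout turns a rational y^n into a rational y^d. The (m/d)-th power
  of y^d is f, so f would be an (m/d)-th power, contrary to hypothesis.\<close>

lemma y_power_notin_rational:
  assumes n: "0 < n" "n < m" and q: "q \<noteq> 0"
  shows "y ^ n * ev q \<noteq> ev p"
proof
  assume eq: "y ^ n * ev q = ev p"
  define d where "d = gcd n m"
  obtain a b where ab: "n * a = m * b + d"
    using bezout_nat[of n m] n unfolding d_def by auto
  have d: "d dvd m" "d > 0" "d < m"
    using n gcd_le1_nat[of n m] by (auto simp: d_def intro: le_less_trans[of _ n])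
  define e where "e = m div d"
  have e: "m = d * e" "e > 1" "e dvd m" using d by (auto simp: e_def elim!: dvdE)
  have "ev (p ^ a) = (y ^ n * ev q) ^ a" by (simp add: eq ev.hom_power)
  also have "\<dots> = y ^ (n * a) * ev (q ^ a)" by (simp add: power_mult_distrib power_mult ev.hom_power)
  also have "y ^ (n * a) = ev (f ^ b) * y ^ d"
    by (simp add: ab power_add power_mult ev.hom_power ev_f)
  finally have "ev (p ^ a) = y ^ d * ev (f ^ b * q ^ a)" by (simp add: ev.hom_mult mult_ac)
  hence "ev (p ^ a) ^ e = y ^ m * ev (f ^ b * q ^ a) ^ e"
    by (simp add: power_mult_distrib e(1) power_mult)
  hence "ev ((p ^ a) ^ e) = ev (f * (f ^ b * q ^ a) ^ e)"
    by (simp add: ev.hom_power ev.hom_mult ev_f)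
  hence "f * (f ^ b * q ^ a) ^ e = (p ^ a) ^ e" by (simp only: ev_inj)
  moreover have "f ^ b * q ^ a \<noteq> 0" using f_nz q by simp
  ultimately show False using not_power e(2,3) unfolding f_def by blast
qed

lemma map_poly_ev_G: "map_poly ev G = (\<Prod>z\<in>roots_unity m. [:- (\<iota> z * y), 1:])"
proof -
  have "unital_hom (\<lambda>c. [:\<iota> c:])"
    by unfold_locales (simp_all add: \<iota>.hom_0 \<iota>.hom_1 \<iota>.hom_add \<iota>.hom_mult one_pCons)
  moreover have "[:y:] * [:inverse y:] = 1" by (simp add: one_pCons)
  ultimately have "[:0, 1:] ^ m - [:y:] ^ m = (\<Prod>z\<in>roots_unity m. [:0, 1:] - [:\<iota> z:] * [:y:])"
    by (rule power_diff_factorization_unit[OF _ ac m_nz])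
  moreover have "[:0, 1:] ^ m = (monom 1 m :: 'f poly)" by (simp add: monom_altdef)
  hence "[:0, 1:] ^ m - [:y:] ^ m = map_poly ev G"
    by (intro poly_eqI)
       (simp add: coeff_map_poly G_def ev.hom_diff poly_const_pow coeff_diff coeff_pCons ev_f
          split: nat.split)
  ultimately show ?thesis by (simp add: mult.commute)
qed

text \<open>A relation D of least degree divides a scalar multiple of \<open>G\<close>, so over F it
  is, up to a scalar, a product of factors Y - \<zeta> y. Its constant term then exhibits y^(degree
  D) as an element of K(x) with 0 < degree D < m.\<close>

lemma lin_indep_poly:
  assumes "degree P < m" "ev2 P = 0"
  shows "P = 0"
proof (rule ccontr)
  assume "P \<noteq> 0"
  then obtain D where D: "D \<noteq> 0" "ev2 D = 0" and least: "\<And>Q. Q \<noteq> 0 \<Longrightarrow> ev2 Q = 0 \<Longrightarrow> degree D \<le> degree Q"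
    using ex_has_least_nat[of "\<lambda>Q. Q \<noteq> 0 \<and> ev2 Q = 0" P degree] assms by blast
  have Dm: "degree D < m" using least[of P] assms \<open>P \<noteq> 0\<close> by simp
  \<comment> \<open>The coefficients lie in K[x], which is not a field, so division with remainder
    costs a scalar a. Minimality of D makes the remainder vanish.\<close>
  obtain a q where aq: "a \<noteq> 0" "smult a G = D * q + pseudo_mod G D"
    using pseudo_mod(1)[OF D(1), of G] by blast
  have "ev2 (smult a G) = ev2 (D * q) + ev2 (pseudo_mod G D)" unfolding aq(2) by (rule ev2.hom_add)
  hence "ev2 (pseudo_mod G D) = 0"
    by (simp add: ev.hom_eval_smult ev2_G ev2.hom_mult D)
  with least[of "pseudo_mod G D"] pseudo_mod(2)[OF D(1), of G] have "pseudo_mod G D = 0" by force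
  with aq have "smult a G = D * q" by simp
  hence "map_poly ev (smult a G) = map_poly ev D * map_poly ev q" by (simp add: ev.map_poly_mult_hom)
  hence "smult (ev a) (map_poly ev G) = map_poly ev D * map_poly ev q"
    by (subst (asm) map_poly_smult) (simp_all add: ev.hom_mult ev.hom_0)
  hence "map_poly ev D dvd smult (ev a) (map_poly ev G)" by simp
  hence "map_poly ev D dvd map_poly ev G" using aq(1) by (simp add: dvd_smult_iff)
  from dvd_prod_linear_imp[OF _ this[unfolded map_poly_ev_G]] roots_unity_factorization(3)[OF ac m_nz]
  obtain B where B: "B \<subseteq> roots_unity m"
     "map_poly ev D = smult (lead_coeff (map_poly ev D)) (\<Prod>z\<in>B. [:- (\<iota> z * y), 1:])" by blast
  have degD: "degree (map_poly ev D) = degree D" by (rule map_poly_degree_eq) (use D in auto)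
  have lcD: "lead_coeff (map_poly ev D) = ev (lead_coeff D)" by (simp add: degD coeff_map_poly ev.hom_0)
  have "degree D = degree (\<Prod>z\<in>B. [:- (\<iota> z * y), 1:])"
    unfolding degD[symmetric] by (subst B(2)) (simp only: lcD degree_smult_eq ev_eq_0_iff leading_coeff_0_iff D(1) if_False)
  also have "\<dots> = (\<Sum>z\<in>B. 1)" by (subst degree_prod_sum_eq) auto
  finally have cardB: "card B = degree D" by simp
  have "ev (coeff D 0) = poly (map_poly ev D) 0" by (simp add: poly_0_coeff_0 coeff_map_poly ev.hom_0)
  also have "\<dots> = ev (lead_coeff D) * (\<Prod>z\<in>B. \<iota> (- z) * y)"
    by (subst B(2)) (simp add: lcD poly_prod \<iota>.hom_minus)
  also have "\<dots> = y ^ degree D * ev (smult (\<Prod>z\<in>B. - z) (lead_coeff D))"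
    by (simp add: prod.distrib cardB \<iota>.hom_eval_smult \<iota>.hom_prod)
  finally have eq: "y ^ degree D * ev (smult (\<Prod>z\<in>B. - z) (lead_coeff D)) = ev (coeff D 0)" by simp
  have fB: "finite B" using B(1) roots_unity_factorization(3)[OF ac m_nz] by (rule finite_subset)
  have "0 \<notin> B" using B(1) m_pos by (auto simp: roots_unity_def zero_power)
  hence "(\<Prod>z\<in>B. - z) \<noteq> 0" using fB by auto
  moreover have "degree D > 0"
  proof (rule ccontr)
    assume "\<not> degree D > 0"
    then obtain c where "D = [:c:]" by (metis degree_eq_zeroE not_gr_zero)
    thus False using D by simp
  qed
  ultimately show False using y_power_notin_rational[OF _ Dm] eq D(1) by auto
qed

lemma reduce_mod_G: "\<exists>Q R. P = G * Q + R \<and> degree R < m"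
proof -
  obtain Q R where QR: "pseudo_divmod P G = (Q, R)" by (metis surj_pair)
  have "P = G * Q + R" using pseudo_divmod(1)[OF G_nz QR] unfolding lead_coeff_G by simp
  moreover have "degree R < m" using pseudo_divmod(2)[OF G_nz QR] m_pos unfolding degree_G by auto
  ultimately show ?thesis by blast
qed

text \<open>An element D of least degree in the ideal of P and \<open>G\<close> divides both up to
  scalars. If its degree were positive, its cofactor in \<open>G\<close> would be a non-zero
  relation for y of degree below m. So D lies in K[x], and inverses need denominators in x
  only.\<close>

lemma ev2_inverse:
  assumes "ev2 P \<noteq> 0"
  shows "\<exists>A d. d \<noteq> 0 \<and> ev2 A * ev2 P = ev d"
proof -
  let ?I = "\<lambda>D. D \<noteq> 0 \<and> (\<exists>A B. D = A * P + B * G)"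
  have "P \<noteq> 0" using assms by auto
  moreover have "P = 1 * P + 0 * G" by simp
  ultimately have "?I P" by blast
  then obtain D where D: "?I D" and least: "\<And>Q. ?I Q \<Longrightarrow> degree D \<le> degree Q"
    using ex_has_least_nat[of ?I P degree] by blast
  from D obtain A B where AB: "D = A * P + B * G" and D0: "D \<noteq> 0" by blast
  have dvd: "\<exists>a q. a \<noteq> 0 \<and> smult a (A' * P + B' * G) = D * q" for A' B'
  proof -
    let ?Q = "A' * P + B' * G"
    obtain a q where aq: "a \<noteq> 0" "smult a ?Q = D * q + pseudo_mod ?Q D"
      using pseudo_mod(1)[OF D0] by blast
    have "pseudo_mod ?Q D = smult a ?Q - D * q" using aq(2) by simp
    also have "\<dots> = (smult a A' - A * q) * P + (smult a B' - B * q) * G"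
      by (simp add: AB algebra_simps smult_add_right)
    finally have "\<exists>A B. pseudo_mod ?Q D = A * P + B * G" by blast
    with least[of "pseudo_mod ?Q D"] pseudo_mod(2)[OF D0, of ?Q] have "pseudo_mod ?Q D = 0" by force
    thus ?thesis using aq by auto
  qed
  obtain a q where a: "a \<noteq> 0" "smult a P = D * q" using dvd[of 1 0] by auto
  obtain b q' where b: "b \<noteq> 0" "smult b G = D * q'" using dvd[of 0 1] by auto
  have "ev a * ev2 P = ev2 D * ev2 q" using a(2) by (metis ev.hom_eval_smult ev2.hom_mult)
  hence eD: "ev2 D \<noteq> 0" using a assms by auto
  have "ev2 D * ev2 q' = ev b * ev2 G" using b(2) by (metis ev.hom_eval_smult ev2.hom_mult)
  hence eq': "ev2 q' = 0" using eD by (simp add: ev2_G)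
  have q'0: "q' \<noteq> 0" using b G_nz by auto
  have "degree (smult b G) = m" using b(1) by (simp add: degree_G)
  hence "degree D + degree q' = m" using b(2) D0 q'0 by (simp add: degree_mult_eq)
  hence "degree D = 0" using lin_indep_poly[of q'] eq' q'0 by fastforce
  then obtain d where d: "D = [:d:]" by (metis degree_eq_zeroE)
  have "ev2 A * ev2 P = ev2 D" unfolding AB by (simp add: ev2.hom_add ev2.hom_mult ev2_G)
  also have "\<dots> = ev d" by (simp add: d)
  finally show ?thesis using d D0 by auto
qed

text \<open>Fractions with numerator in K[x][y] and denominator in K[x] include the generators and
  are closed under the field operations, so \<open>generated_by\<close> makes them exhaust
  F.\<close>

lemma representation: "\<exists>P q. q \<noteq> 0 \<and> z * ev q = ev2 P"
proof -
  let ?S = "{z. \<exists>P q. q \<noteq> 0 \<and> z * ev q = ev2 P}"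
  have "\<iota> c * ev 1 = ev2 [:[:c:]:]" "x * ev 1 = ev2 [:[:0, 1:]:]" "y * ev 1 = ev2 [:0, 1:]" for c
    by (simp_all add: \<iota>.hom_0 \<iota>.hom_1)
  hence 1: "range \<iota> \<subseteq> ?S" "x \<in> ?S" "y \<in> ?S" using one_neq_zero by blast+
  have 2: "a + b \<in> ?S \<and> a * b \<in> ?S \<and> - a \<in> ?S \<and> inverse a \<in> ?S" if ab: "a \<in> ?S" "b \<in> ?S" for a b
  proof -
    obtain P q P' q' where *: "q \<noteq> 0" "a * ev q = ev2 P" "q' \<noteq> 0" "b * ev q' = ev2 P'" using ab by blast
    have "(a + b) * ev (q * q') = (a * ev q) * ev q' + (b * ev q') * ev q"
      by (simp add: ev.hom_mult algebra_simps)
    also have "\<dots> = ev2 (P * [:q':] + P' * [:q:])"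
      unfolding * by (simp add: ev2.hom_add ev2.hom_mult del: mult_pCons_right)
    finally have add: "(a + b) * ev (q * q') = ev2 (P * [:q':] + P' * [:q:])" .
    have mult: "(a * b) * ev (q * q') = ev2 (P * P')"
      unfolding ev2.hom_mult *(2)[symmetric] *(4)[symmetric] by (simp add: ev.hom_mult)
    have neg: "- a * ev q = ev2 (- P)" using * by (simp add: ev2.hom_minus)
    have inv: "\<exists>P q. q \<noteq> 0 \<and> inverse a * ev q = ev2 P"
    proof (cases "a = 0")
      case True thus ?thesis by (intro exI[of _ 0] exI[of _ 1]) simp
    next
      case False
      hence "ev2 P \<noteq> 0" using *(1) by (simp add: *(2)[symmetric])
      then obtain A d where Ad: "d \<noteq> 0" "ev2 A * ev2 P = ev d" using ev2_inverse by blast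
      have "inverse a * ev d = inverse a * a * (ev2 A * ev q)"
        unfolding Ad(2)[symmetric] *(2)[symmetric] by (simp add: algebra_simps)
      also have "\<dots> = ev2 (A * [:q:])" using False by (simp add: ev2.hom_mult del: mult_pCons_right)
      finally show ?thesis using Ad(1) by blast
    qed
    have "q * q' \<noteq> 0" using * by simp
    thus ?thesis using add mult neg inv *(1) by blast
  qed
  have "\<forall>a\<in>?S. \<forall>b\<in>?S. a + b \<in> ?S \<and> a * b \<in> ?S \<and> - a \<in> ?S \<and> inverse a \<in> ?S"
    by (intro ballI 2)
  hence "?S = UNIV"
    using generated[unfolded generated_by_def, THEN spec, of ?S] 1 by (simp only: simp_thms)
  thus ?thesis by blast
qed

text \<open>F is the fraction field of K[x][Y] modulo \<open>G\<close>, so only the equation of y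
  has to be respected. With Laurent series as target this produces places, with F as target the
  conjugations y -> \<zeta> y.\<close>

lemma hom_extension:
  fixes h :: "'k \<Rightarrow> 'l::field"
  assumes h: "unital_hom h" and \<xi>: "\<And>p. p \<noteq> 0 \<Longrightarrow> hom_eval h \<xi> p \<noteq> 0" and \<eta>: "\<eta> ^ m = hom_eval h \<xi> f"
  shows "\<exists>\<phi>. unital_hom \<phi> \<and> \<phi> x = \<xi> \<and> \<phi> y = \<eta> \<and> (\<forall>c. \<phi> (\<iota> c) = h c)"
proof -
  interpret h: unital_hom h by fact
  let ?e = "hom_eval h \<xi>"
  interpret e: unital_hom ?e by (rule h.hom_eval_unital_hom)
  let ?e2 = "hom_eval ?e \<eta>"
  interpret e2: unital_hom ?e2 by (rule e.hom_eval_unital_hom)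
  have G: "?e2 G = 0" unfolding G_def e2.hom_diff by (simp add: e.hom_eval_monom \<eta>)
  \<comment> \<open>Every relation for y is a multiple of \<open>G\<close>, as its remainder is a
    relation of degree below m. Hence evaluation at \<eta> does not depend on the chosen
    fraction.\<close>
  have ker: "?e2 P = 0" if "ev2 P = 0" for P
  proof -
    obtain Q R where QR: "P = G * Q + R" "degree R < m" using reduce_mod_G by blast
    have "ev2 R = 0" using that unfolding QR(1) by (simp add: ev2.hom_add ev2.hom_mult ev2_G)
    hence "R = 0" using lin_indep_poly QR(2) by blast
    thus ?thesis unfolding QR(1) by (simp add: e2.hom_mult G)
  qed
  define \<phi> where "\<phi> z = (let Pq = (SOME Pq. snd Pq \<noteq> 0 \<and> z * ev (snd Pq) = ev2 (fst Pq)) in ?e2 (fst Pq) / ?e (snd Pq))" for z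
  have key: "\<phi> z = ?e2 P / ?e q" if q: "q \<noteq> 0" and z: "z * ev q = ev2 P" for z P q
  proof -
    define Pq where "Pq = (SOME Pq. snd Pq \<noteq> 0 \<and> z * ev (snd Pq) = ev2 (fst Pq))"
    have "snd Pq \<noteq> 0 \<and> z * ev (snd Pq) = ev2 (fst Pq)"
      unfolding Pq_def by (rule someI[of _ "(P, q)"]) (use that in simp)
    then obtain P' q' where Pq: "Pq = (P', q')" "q' \<noteq> 0" "z * ev q' = ev2 P'" by (cases Pq) auto
    have "ev2 (P * [:q':] - P' * [:q:]) = 0"
      by (simp add: ev2.hom_diff ev2.hom_mult z[symmetric] Pq(3)[symmetric] del: mult_pCons_right)
    hence "?e2 (P * [:q':] - P' * [:q:]) = 0" by (rule ker)
    hence "?e2 P * ?e q' = ?e2 P' * ?e q" by (simp add: e2.hom_diff e2.hom_mult del: mult_pCons_right)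
    hence "?e2 P' / ?e q' = ?e2 P / ?e q" using \<xi> q Pq(2) by (simp add: frac_eq_eq)
    moreover have "\<phi> z = ?e2 P' / ?e q'" using Pq(1) unfolding \<phi>_def Pq_def by simp
    ultimately show ?thesis by simp
  qed
  have key1: "\<phi> (ev2 P) = ?e2 P" for P using key[of 1 "ev2 P" P] by simp
  have "unital_hom \<phi>"
  proof
    show "\<phi> 0 = 0" "\<phi> 1 = 1" using key1[of 0] key1[of 1] by simp_all
    fix a b
    obtain P q P' q' where *: "q \<noteq> 0" "a * ev q = ev2 P" "q' \<noteq> 0" "b * ev q' = ev2 P'"
      using representation by metis
    have "(a + b) * ev (q * q') = (a * ev q) * ev q' + (b * ev q') * ev q"
      by (simp add: ev.hom_mult algebra_simps)
    also have "\<dots> = ev2 (P * [:q':] + P' * [:q:])"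
      unfolding * by (simp add: ev2.hom_add ev2.hom_mult del: mult_pCons_right)
    finally have add: "(a + b) * ev (q * q') = ev2 (P * [:q':] + P' * [:q:])" .
    have mult: "(a * b) * ev (q * q') = ev2 (P * P')"
      unfolding ev2.hom_mult *(2)[symmetric] *(4)[symmetric] by (simp add: ev.hom_mult)
    have nz: "q * q' \<noteq> 0" "?e q \<noteq> 0" "?e q' \<noteq> 0" using * \<xi> by auto
    show "\<phi> (a + b) = \<phi> a + \<phi> b"
      unfolding key[OF nz(1) add] key[OF *(1,2)] key[OF *(3,4)] using nz
      by (simp add: e2.hom_add e2.hom_mult e.hom_mult field_simps del: mult_pCons_right)
    show "\<phi> (a * b) = \<phi> a * \<phi> b"
      unfolding key[OF nz(1) mult] key[OF *(1,2)] key[OF *(3,4)]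
      by (simp add: e2.hom_mult e.hom_mult)
  qed
  moreover have "\<phi> x = \<xi>" "\<phi> y = \<eta>" using key1[of "[:[:0, 1:]:]"] key1[of "[:0, 1:]"]
    by (simp_all add: \<iota>.hom_0 \<iota>.hom_1 h.hom_0 h.hom_1)
  moreover have "\<phi> (\<iota> c) = h c" for c using key1[of "[:[:c:]:]"] by simp
  ultimately show ?thesis by blast
qed

section \<open>The subfield K(x) and the basis of powers of y\<close>

definition Kx :: "'f set" where "Kx = {z. \<exists>p q. q \<noteq> 0 \<and> z * ev q = ev p}"

lemma Kx_ev [simp]: "ev p \<in> Kx"
  unfolding Kx_def by (intro CollectI exI[of _ p] exI[of _ 1]) simp

lemma Kx_mult: "a \<in> Kx \<Longrightarrow> b \<in> Kx \<Longrightarrow> a * b \<in> Kx"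
proof -
  assume "a \<in> Kx" "b \<in> Kx"
  then obtain p q p' q' where *: "q \<noteq> 0" "a * ev q = ev p" "q' \<noteq> 0" "b * ev q' = ev p'"
    unfolding Kx_def by blast
  have "(a * b) * ev (q * q') = ev (p * p')"
    unfolding ev.hom_mult *(2)[symmetric] *(4)[symmetric] by simp
  moreover have "q * q' \<noteq> 0" using * by simp
  ultimately show ?thesis unfolding Kx_def by blast
qed

lemma Kx_add: "a \<in> Kx \<Longrightarrow> b \<in> Kx \<Longrightarrow> a + b \<in> Kx"
proof -
  assume "a \<in> Kx" "b \<in> Kx"
  then obtain p q p' q' where *: "q \<noteq> 0" "a * ev q = ev p" "q' \<noteq> 0" "b * ev q' = ev p'"
    unfolding Kx_def by blast
  have "(a + b) * ev (q * q') = ev (p * q' + p' * q)"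
    unfolding ev.hom_mult ev.hom_add *(2)[symmetric] *(4)[symmetric] by (simp add: algebra_simps)
  moreover have "q * q' \<noteq> 0" using * by simp
  ultimately show ?thesis unfolding Kx_def by blast
qed

lemma Kx_inverse: "a \<in> Kx \<Longrightarrow> inverse a \<in> Kx"
proof (cases "a = 0")
  case False
  assume "a \<in> Kx"
  then obtain p q where *: "q \<noteq> 0" "a * ev q = ev p" unfolding Kx_def by blast
  have "p \<noteq> 0" using * False by (metis ev_eq_0_iff no_zero_divisors ev.hom_0)
  moreover have "inverse a * ev p = ev q" using False by (simp add: *(2)[symmetric] field_simps)
  ultimately show ?thesis unfolding Kx_def by blast
qed simp

lemma Kx_0 [simp]: "0 \<in> Kx" and Kx_1 [simp]: "1 \<in> Kx" and Kx_x [simp]: "x \<in> Kx"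
  and Kx_\<iota> [simp]: "\<iota> c \<in> Kx" and Kx_linear [simp]: "x - \<iota> c \<in> Kx"
  using Kx_ev[of 0] Kx_ev[of 1] Kx_ev[of "[:0, 1:]"] Kx_ev[of "[:c:]"] Kx_ev[of "[:- c, 1:]"]
  by (simp_all add: \<iota>.hom_0 \<iota>.hom_1 \<iota>.hom_minus)

lemma Kx_sum: "(\<And>i. i \<in> A \<Longrightarrow> g i \<in> Kx) \<Longrightarrow> sum g A \<in> Kx"
  by (induction A rule: infinite_finite_induct) (simp_all add: Kx_add)

lemma Kx_prod: "(\<And>i. i \<in> A \<Longrightarrow> g i \<in> Kx) \<Longrightarrow> prod g A \<in> Kx"
  by (induction A rule: infinite_finite_induct) (simp_all add: Kx_mult)

lemma Kx_power: "a \<in> Kx \<Longrightarrow> a ^ n \<in> Kx"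
  by (induction n) (simp_all add: Kx_mult)

lemma Kx_power_int: "a \<in> Kx \<Longrightarrow> a powi n \<in> Kx"
  by (simp add: power_int_def Kx_power Kx_inverse)

lemma Kx_common_denominator:
  assumes "finite A" "\<And>k. k \<in> A \<Longrightarrow> a k \<in> Kx"
  shows "\<exists>q c. q \<noteq> 0 \<and> (\<forall>k\<in>A. a k * ev q = ev (c k))"
proof -
  have "\<forall>k\<in>A. \<exists>p q. q \<noteq> 0 \<and> a k * ev q = ev p" using assms(2) unfolding Kx_def by blast
  then obtain p q where pq: "\<And>k. k \<in> A \<Longrightarrow> q k \<noteq> 0" "\<And>k. k \<in> A \<Longrightarrow> a k * ev (q k) = ev (p k)" by metis
  have "a k * ev (prod q A) = ev (p k * prod q (A - {k}))" if "k \<in> A" for k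
    using that assms(1) by (simp add: prod.remove[of A k] ev.hom_mult pq(2)[symmetric])
  moreover have "prod q A \<noteq> 0" using pq(1) assms(1) by auto
  ultimately show ?thesis by (intro exI[of _ "prod q A"] exI[of _ "\<lambda>k. p k * prod q (A - {k})"]) blast
qed

lemma lin_indep:
  assumes "\<And>k. k < m \<Longrightarrow> a k \<in> Kx" "(\<Sum>k<m. a k * y ^ k) = 0" "k < m"
  shows "a k = 0"
proof -
  obtain q c where qc: "q \<noteq> 0" "\<And>k. k < m \<Longrightarrow> a k * ev q = ev (c k)"
    using Kx_common_denominator[of "{..<m}" a] assms(1) by auto
  define P where "P = (\<Sum>k<m. monom (c k) k)"
  have degP: "degree P < m"
    unfolding P_def using m_pos
    by (intro degree_sum_less) (auto intro: le_less_trans[OF degree_monom_le])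
  have "ev2 P = (\<Sum>k<m. a k * ev q * y ^ k)"
    unfolding P_def ev2.hom_sum by (intro sum.cong) (auto simp: ev.hom_eval_monom qc)
  also have "\<dots> = ev q * (\<Sum>k<m. a k * y ^ k)" by (simp add: sum_distrib_left mult_ac)
  finally have "P = 0" using lin_indep_poly degP assms(2) by simp
  hence "coeff P k = 0" by simp
  hence "c k = 0" using assms(3) by (simp add: P_def coeff_sum)
  thus ?thesis using qc assms(3) by (metis ev.hom_0 ev_eq_0_iff no_zero_divisors)
qed

text \<open>Reduction modulo \<open>G\<close> brings the numerator below degree m in y. Together
  with \<open>lin_indep\<close>, this makes 1, y, ..., y^(m-1) a basis of F over K(x).\<close>

lemma decomposition: "\<exists>a. (\<forall>k. a k \<in> Kx) \<and> z = (\<Sum>k<m. a k * y ^ k)"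
proof -
  obtain P q where q: "q \<noteq> 0" "z * ev q = ev2 P" using representation by blast
  obtain Q R where QR: "P = G * Q + R" "degree R < m" using reduce_mod_G by blast
  have "z * ev q = ev2 R" using q(2) unfolding QR(1) by (simp add: ev2.hom_add ev2.hom_mult ev2_G)
  also have "\<dots> = (\<Sum>k<m. ev (coeff R k) * y ^ k)" by (rule ev.hom_eval_as_sum[OF QR(2)])
  finally have "z = (\<Sum>k<m. ev (coeff R k) * y ^ k) * inverse (ev q)" using q(1) by (simp add: field_simps)
  also have "\<dots> = (\<Sum>k<m. (ev (coeff R k) * inverse (ev q)) * y ^ k)"
    unfolding sum_distrib_right by (simp add: mult_ac)
  finally show ?thesis
    by (intro exI[of _ "\<lambda>k. ev (coeff R k) * inverse (ev q)"]) (simp add: Kx_mult Kx_inverse)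
qed

end

section \<open>Valuations and places\<close>

locale valuation =
  fixes v :: "'f::field \<Rightarrow> int"
  assumes v_mult: "a \<noteq> 0 \<Longrightarrow> b \<noteq> 0 \<Longrightarrow> v (a * b) = v a + v b"
    and v_add: "a \<noteq> 0 \<Longrightarrow> b \<noteq> 0 \<Longrightarrow> a + b \<noteq> 0 \<Longrightarrow> v (a + b) \<ge> min (v a) (v b)"
begin

text \<open>The value at 0 is only a convention, so lower bounds treat 0 as having infinite value;
  they then survive sums whose terms cancel.\<close>

definition vge :: "'f \<Rightarrow> int \<Rightarrow> bool" where "vge a n \<longleftrightarrow> a = 0 \<or> v a \<ge> n"

lemma v_1 [simp]: "v 1 = 0"
  using v_mult[of 1 1] by simp

lemma v_minus [simp]: "v (- a) = v a"
proof (cases "a = 0")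
  case False
  have "v (- 1) = 0" using v_mult[of "- 1" "- 1"] by simp
  thus ?thesis using v_mult[of "- 1" a] False by simp
qed simp

lemma v_inverse: "a \<noteq> 0 \<Longrightarrow> v (inverse a) = - v a"
  using v_mult[of a "inverse a"] by simp

lemma v_power: "a \<noteq> 0 \<Longrightarrow> v (a ^ n) = int n * v a"
  by (induction n) (simp_all add: v_mult algebra_simps)

lemma v_power_int: "a \<noteq> 0 \<Longrightarrow> v (a powi n) = n * v a"
  by (simp add: power_int_def v_power v_inverse)

lemma v_prod: "finite A \<Longrightarrow> (\<And>i. i \<in> A \<Longrightarrow> g i \<noteq> 0) \<Longrightarrow> v (prod g A) = (\<Sum>i\<in>A. v (g i))"
proof (induction A rule: finite_induct)
  case (insert a A)
  hence "prod g A \<noteq> 0" "g a \<noteq> 0" by auto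
  thus ?case using insert by (simp add: v_mult)
qed simp

lemma vge_0 [simp]: "vge 0 n" by (simp add: vge_def)

lemma vge_add: "vge a n \<Longrightarrow> vge b n \<Longrightarrow> vge (a + b) n"
  using v_add[of a b] by (cases "a = 0"; cases "b = 0"; cases "a + b = 0") (auto simp: vge_def)

lemma vge_minus: "vge (- a) n \<longleftrightarrow> vge a n" by (simp add: vge_def)

lemma vge_diff: "vge a n \<Longrightarrow> vge b n \<Longrightarrow> vge (a - b) n"
  using vge_add[of a n "- b"] by (simp add: vge_minus)

lemma vge_mult: "vge a n \<Longrightarrow> vge b k \<Longrightarrow> vge (a * b) (n + k)"
  using v_mult[of a b] by (cases "a = 0"; cases "b = 0") (auto simp: vge_def)

lemma vge_sum: "(\<And>i. i \<in> A \<Longrightarrow> vge (g i) n) \<Longrightarrow> vge (sum g A) n"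
  by (induction A rule: infinite_finite_induct) (simp_all add: vge_add)

text \<open>If the value of the sum exceeded that of a, then a = (a + b) - b would be a difference
  of two elements of larger value.\<close>

lemma v_add_dominant:
  assumes "a \<noteq> 0" "vge b n" "v a < n"
  shows "a + b \<noteq> 0 \<and> v (a + b) = v a"
proof (cases "b = 0")
  case False
  hence b: "v a < v b" using assms by (simp add: vge_def)
  have nz: "a + b \<noteq> 0"
  proof
    assume "a + b = 0"
    hence "b = - a" by (simp add: eq_neg_iff_add_eq_0 add.commute)
    thus False using b by simp
  qed
  have "v (a + b) \<ge> v a" using v_add[OF assms(1) False nz] b by simp
  moreover have "v a \<ge> min (v (a + b)) (v b)"
    using v_add[of "a + b" "- b"] nz False assms(1) by simp
  ultimately show ?thesis using nz b by simp
qed (use assms in simp)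

lemma v_sum_distinct:
  assumes "finite A" "A \<noteq> {}" "\<And>i. i \<in> A \<Longrightarrow> g i \<noteq> 0" "inj_on (\<lambda>i. v (g i)) A"
  shows "sum g A \<noteq> 0 \<and> (\<exists>i\<in>A. v (sum g A) = v (g i))"
  using assms
proof (induction A rule: finite_ne_induct)
  case (insert a A)
  then obtain i where i: "sum g A \<noteq> 0" "i \<in> A" "v (sum g A) = v (g i)" by auto
  have ga: "g a \<noteq> 0" using insert.prems by simp
  have ne: "v (g a) \<noteq> v (g i)" using insert.prems(2) insert.hyps i(2) by (auto simp: inj_on_def)
  have s: "sum g (insert a A) = g a + sum g A" using insert.hyps by simp
  show ?case
  proof (cases "v (g a) < v (g i)")
    case True
    thus ?thesis unfolding s using v_add_dominant[OF ga, of "sum g A" "v (g i)"] i by (auto simp: vge_def)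
  next
    case False
    thus ?thesis unfolding s using v_add_dominant[OF i(1), of "g a" "v (g a)"] i ne
      by (auto simp: vge_def add.commute)
  qed
qed simp

end

section \<open>Local parameters and orders at the points of the projective line\<close>

definition ord_at :: "'k::field option \<Rightarrow> 'k poly \<Rightarrow> int" where
  "ord_at P p = (case P of Some b \<Rightarrow> int (order b p) | None \<Rightarrow> - int (degree p))"

definition loc_param :: "('k::field \<Rightarrow> 'f::field) \<Rightarrow> 'f \<Rightarrow> 'k option \<Rightarrow> 'f" where
  "loc_param h \<xi> P = (case P of Some b \<Rightarrow> \<xi> - h b | None \<Rightarrow> inverse \<xi>)"

text \<open>Taylor expansion at b and reversal of the coefficients at infinity bring all points to
  one form. The factor with non-zero constant term is a unit wherever the local parameter has
  positive value.\<close>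

lemma (in unital_field_hom) local_form:
  assumes "loc_param h \<xi> P \<noteq> 0" "p \<noteq> 0"
  shows "\<exists>q. poly q 0 \<noteq> 0 \<and>
     hom_eval h \<xi> p = loc_param h \<xi> P powi ord_at P p * hom_eval h (loc_param h \<xi> P) q"
proof (cases P)
  case (Some b)
  interpret e: unital_hom "hom_eval h \<xi>" by (rule hom_eval_unital_hom)
  obtain q where q: "p = [:- b, 1:] ^ order b p * q" "\<not> [:- b, 1:] dvd q"
    using order_decomp[OF assms(2)] by blast
  have "hom_eval h (\<xi> - h b) (pcompose q [:b, 1:]) = hom_eval h \<xi> q" for q
  proof (induction q)
    case (pCons a q)
    interpret e': unital_hom "hom_eval h (\<xi> - h b)" by (rule hom_eval_unital_hom)
    show ?case unfolding pcompose_pCons e'.hom_add e'.hom_mult pCons.IH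
      by (simp add: hom_0 hom_1)
  qed simp
  moreover have "hom_eval h \<xi> p = (\<xi> - h b) ^ order b p * hom_eval h \<xi> q"
    by (subst q(1)) (simp add: e.hom_mult e.hom_power hom_1 hom_minus algebra_simps del: hom_power)
  moreover have "poly (pcompose q [:b, 1:]) 0 \<noteq> 0"
    using q(2) by (simp add: poly_pcompose poly_eq_0_iff_dvd)
  ultimately show ?thesis using Some
    by (intro exI[of _ "pcompose q [:b, 1:]"]) (simp add: loc_param_def ord_at_def)
next
  case None
  hence x0: "\<xi> \<noteq> 0" using assms(1) by (auto simp: loc_param_def)
  have "\<exists>q. poly q 0 \<noteq> 0 \<and> hom_eval h \<xi> p = \<xi> ^ degree p * hom_eval h (inverse \<xi>) q"
    using assms(2)
  proof (induction p)
    case (pCons a p)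
    show ?case
    proof (cases "p = 0")
      case True
      thus ?thesis using pCons.hyps by (intro exI[of _ "[:a:]"]) simp
    next
      case False
      then obtain q where q: "poly q 0 \<noteq> 0" "hom_eval h \<xi> p = \<xi> ^ degree p * hom_eval h (inverse \<xi>) q"
        using pCons.IH by blast
      have "hom_eval h \<xi> (pCons a p)
          = \<xi> ^ degree (pCons a p) * hom_eval h (inverse \<xi>) (q + monom a (Suc (degree p)))"
        using False x0 by (simp add: q(2) hom_eval_add hom_eval_monom field_simps)
      moreover have "poly (q + monom a (Suc (degree p))) 0 \<noteq> 0" using q(1) by (simp add: poly_monom)
      ultimately show ?thesis by blast
    qed
  qed simp
  thus ?thesis using None
    by (simp add: loc_param_def ord_at_def power_int_minus power_inverse)
qed

text \<open>Covers both the order of Laurent series, from which places are built, and an arbitrary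
  place of F.\<close>

locale const_valuation = valuation v + unital_field_hom h
  for v :: "'f::field \<Rightarrow> int" and h :: "'k::field \<Rightarrow> 'f" +
  assumes v_const: "c \<noteq> 0 \<Longrightarrow> v (h c) = 0"
begin

lemma vge_const [simp]: "vge (h c) 0"
  using v_const by (cases "c = 0") (auto simp: vge_def hom_0)

lemma vge_hom_eval: "vge t 0 \<Longrightarrow> vge (hom_eval h t q) 0"
proof (induction q)
  case (pCons a q)
  thus ?case using vge_mult[of t 0 "hom_eval h t q" 0] by (simp add: vge_add)
qed simp

lemma v_hom_eval_unit:
  assumes "poly q 0 \<noteq> 0" "t \<noteq> 0" "v t > 0"
  shows "hom_eval h t q \<noteq> 0 \<and> v (hom_eval h t q) = 0"
proof (cases q)
  case (pCons c q')
  have "vge t 1" "vge t 0" using assms by (auto simp: vge_def)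
  hence "vge (t * hom_eval h t q') 1" using vge_mult[of t 1 _ 0] vge_hom_eval by simp
  moreover have "c \<noteq> 0" using assms(1) pCons by simp
  ultimately show ?thesis using v_add_dominant[of "h c" _ 1] v_const[of c] pCons
    by (simp add: hom_eq_0_iff)
qed

lemma v_hom_eval:
  assumes "p \<noteq> 0" "loc_param h \<xi> P \<noteq> 0" "v (loc_param h \<xi> P) > 0"
  shows "hom_eval h \<xi> p \<noteq> 0 \<and> v (hom_eval h \<xi> p) = v (loc_param h \<xi> P) * ord_at P p"
proof -
  obtain q where q: "poly q 0 \<noteq> 0"
    "hom_eval h \<xi> p = loc_param h \<xi> P powi ord_at P p * hom_eval h (loc_param h \<xi> P) q"
    using local_form[OF assms(2,1)] by blast
  note u = v_hom_eval_unit[OF q(1) assms(2,3)]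
  show ?thesis unfolding q(2) using u assms(2) by (simp add: v_mult v_power_int)
qed

end

lemma gcd_quotient_eq_1:
  fixes g a b :: int
  assumes "g > 0" "gcd (g * a) (g * b) = g"
  shows "gcd a b = 1"
proof -
  have "g * gcd a b = g * 1" using gcd_mult_distrib'[of g a b] assms by simp
  thus ?thesis using assms(1) by (simp only: mult_cancel_left) simp
qed

section \<open>Galois conjugations and existence of places\<close>

context kummer
begin

abbreviation tp :: "'k option \<Rightarrow> 'f" where "tp \<equiv> loc_param \<iota> x"

lemma tp_nz [simp]: "tp P \<noteq> 0"
  by (simp add: loc_param_def split: option.split del: right_minus_eq)

lemma tp_Kx [simp]: "tp P \<in> Kx"
  by (simp add: loc_param_def Kx_inverse split: option.split)

lemma lies_over_iff:
  assumes "is_place \<iota> v"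
  shows "lies_over \<iota> x v P \<longleftrightarrow> v (tp P) > 0"
proof -
  interpret valuation v using assms by unfold_locales (auto simp: is_place_def)
  show ?thesis by (simp add: lies_over_def loc_param_def v_inverse split: option.split)
qed

lemma fixes_Kx:
  assumes "unital_hom \<sigma>" "\<sigma> x = x" "\<And>c. \<sigma> (\<iota> c) = \<iota> c" "a \<in> Kx"
  shows "\<sigma> a = a"
proof -
  interpret \<sigma>: unital_field_hom \<sigma> using assms(1) by (simp add: unital_field_hom_def)
  have ev: "\<sigma> (ev p) = ev p" for p
    by (induction p) (simp_all add: \<sigma>.hom_0 \<sigma>.hom_add \<sigma>.hom_mult assms)
  obtain p q where pq: "q \<noteq> 0" "a * ev q = ev p" using assms(4) unfolding Kx_def by blast
  have "\<sigma> a * ev q = a * ev q"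
    using \<sigma>.hom_mult[of a "ev q"] unfolding pq(2) ev by simp
  thus ?thesis using pq(1) by simp
qed

text \<open>Comes from \<open>hom_extension\<close>, as \<zeta> y satisfies the same equation as y.
  The range is a subfield containing the generators, hence everything; surjectivity is what keeps a
  place composed with \<sigma> normalized.\<close>

lemma galois_conjugation:
  assumes "z0 \<in> roots_unity m"
  shows "\<exists>\<sigma>. unital_hom \<sigma> \<and> surj \<sigma> \<and> \<sigma> x = x \<and> \<sigma> y = \<iota> z0 * y \<and> (\<forall>c. \<sigma> (\<iota> c) = \<iota> c)"
proof -
  have z: "z0 ^ m = 1" using assms by (simp add: roots_unity_def)
  have "(\<iota> z0 * y) ^ m = ev f"
    by (simp add: power_mult_distrib \<iota>.hom_power[symmetric] z \<iota>.hom_1 ev_f)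
  then obtain \<sigma> where \<sigma>: "unital_hom \<sigma>" "\<sigma> x = x" "\<sigma> y = \<iota> z0 * y" "\<forall>c. \<sigma> (\<iota> c) = \<iota> c"
    using hom_extension[OF \<iota>.unital_hom_axioms, of x "\<iota> z0 * y"] by auto
  interpret \<sigma>: unital_field_hom \<sigma> using \<sigma>(1) by (simp add: unital_field_hom_def)
  have z0: "z0 \<noteq> 0" using z m_pos by (auto simp: zero_power)
  have "\<sigma> (\<iota> (inverse z0) * y) = \<iota> (inverse z0 * z0) * y"
    unfolding \<sigma>.hom_mult \<iota>.hom_mult \<sigma>(3) using \<sigma>(4) by (simp add: mult.assoc)
  hence "y = \<sigma> (\<iota> (inverse z0) * y)" using z0 by (simp add: \<iota>.hom_1)
  hence "y \<in> range \<sigma>" by (rule range_eqI)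
  moreover have "x \<in> range \<sigma>" using \<sigma>(2) by (metis rangeI)
  moreover have "range \<iota> \<subseteq> range \<sigma>" using \<sigma>(4) by (metis image_subset_iff rangeI)
  moreover have "\<forall>a\<in>range \<sigma>. \<forall>b\<in>range \<sigma>. a + b \<in> range \<sigma> \<and> a * b \<in> range \<sigma> \<and> - a \<in> range \<sigma> \<and> inverse a \<in> range \<sigma>"
    by (auto simp flip: \<sigma>.hom_add \<sigma>.hom_mult \<sigma>.hom_minus \<sigma>.hom_inverse)
  ultimately have "surj \<sigma>"
    using generated[unfolded generated_by_def, THEN spec, of "range \<sigma>"] by (simp only: simp_thms)
  with \<sigma> show ?thesis by blast
qed

text \<open>Sends the local parameter to T^e with e = m/g and g = gcd(m, l). The image of f then has
  order e l = m (l/g), so it has an m-th root and F embeds into Laurent series in T. Pulled back,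
  the order takes the coprime values e on \<open>tp P\<close> and l/g on y.\<close>

lemma place_exists: "\<exists>v. is_place \<iota> v \<and> v (tp P) > 0"
proof -
  define l where "l = ord_at P f"
  define g where "g = gcd (int m) l"
  have g0: "g > 0" using m_pos by (simp add: g_def)
  have gm: "g dvd int m" "g dvd l" by (simp_all add: g_def)
  define e where "e = nat (int m div g)"
  have e: "int m = g * int e" using gm(1) g0 by (simp add: e_def pos_imp_zdiv_nonneg_iff)
  have e0: "e > 0" using e m_pos by (cases e) auto
  define \<xi> :: "'k fls" where "\<xi> = (case P of Some b \<Rightarrow> fls_const b + fls_X ^ e | None \<Rightarrow> fls_X_inv ^ e)"
  interpret S: const_valuation fls_subdegree "fls_const :: 'k \<Rightarrow> 'k fls"
    by unfold_locales (auto simp: fls_plus_subdegree fls_plus_const)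
  have par: "loc_param fls_const \<xi> P = fls_X ^ e"
    by (simp add: loc_param_def \<xi>_def fls_inverse_X_inv power_inverse split: option.split)
       (simp flip: power_inverse add: fls_inverse_X_inv)
  have par0: "loc_param fls_const \<xi> P \<noteq> 0" "fls_subdegree (loc_param fls_const \<xi> P) = int e"
    unfolding par by simp_all
  have hv: "hom_eval fls_const \<xi> p \<noteq> 0 \<and> fls_subdegree (hom_eval fls_const \<xi> p) = int e * ord_at P p"
    if "p \<noteq> 0" for p using S.v_hom_eval[OF that par0(1)] par0(2) e0 by simp
  obtain k where k: "l = g * k" using gm(2) by blast
  have "int m dvd fls_subdegree (hom_eval fls_const \<xi> f)"
    using hv[OF f_nz] by (simp add: l_def[symmetric] k e algebra_simps)
  then obtain \<eta> where \<eta>: "\<eta> ^ m = hom_eval fls_const \<xi> f"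
    using fls_root_exists[OF ac m_nz] hv[OF f_nz] by blast
  obtain \<phi> where \<phi>: "unital_hom \<phi>" "\<phi> x = \<xi>" "\<phi> y = \<eta>" "\<forall>c. \<phi> (\<iota> c) = fls_const c"
    using hom_extension[OF S.unital_hom_axioms _ \<eta>] hv by blast
  interpret \<phi>: unital_field_hom \<phi> using \<phi>(1) by (simp add: unital_field_hom_def)
  define v where "v z = fls_subdegree (\<phi> z)" for z
  interpret v: valuation v
  proof
    fix a b :: 'f assume "a \<noteq> 0" "b \<noteq> 0"
    thus "v (a * b) = v a + v b" by (simp add: v_def \<phi>.hom_mult \<phi>.hom_eq_0_iff)
    assume "a + b \<noteq> 0"
    hence "\<phi> a + \<phi> b \<noteq> 0" by (simp add: \<phi>.hom_eq_0_iff flip: \<phi>.hom_add)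
    thus "v (a + b) \<ge> min (v a) (v b)"
      unfolding v_def \<phi>.hom_add by (rule fls_plus_subdegree)
  qed
  have \<phi>t: "\<phi> (tp P) = loc_param fls_const \<xi> P"
    using \<phi> by (simp add: loc_param_def \<phi>.hom_diff \<phi>.hom_inverse split: option.split)
  have vt: "v (tp P) = int e" by (simp add: v_def \<phi>t par0)
  have "int m * v y = fls_subdegree (\<eta> ^ m)" by (simp add: v_def \<phi>(3) fls_subdegree_pow)
  also have "\<dots> = int m * k"
    unfolding \<eta> using hv[OF f_nz] by (simp add: l_def[symmetric] k e algebra_simps)
  finally have vy: "v y = k" using m_pos by simp
  have "gcd (int e) k = 1"
    by (rule gcd_quotient_eq_1[OF g0]) (simp only: e[symmetric] k[symmetric] g_def[symmetric])
  \<comment> \<open>Bezout coefficients for these coprime values give an element of value 1, as a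
    place requires.\<close>
  then obtain a b where ab: "a * int e + b * k = 1" by (metis bezout_int)
  define t where "t = tp P powi a * y powi b"
  have "t \<noteq> 0" "v t = 1" using ab by (simp_all add: t_def v.v_mult v.v_power_int vt vy)
  moreover have "v (\<iota> c) = 0" if "c \<noteq> 0" for c using \<phi>(4) by (simp add: v_def)
  ultimately have "is_place \<iota> v"
    unfolding is_place_def using v.v_mult v.v_add by (auto simp: v_def \<phi>.hom_0)
  thus ?thesis using vt e0 by auto
qed

end

section \<open>Ramification index of an arbitrary place\<close>

locale kummer_place = kummer \<iota> x y m r \<alpha> lam
  for \<iota> :: "'k::field \<Rightarrow> 'f::field" and x y and m r :: nat and \<alpha> :: "nat \<Rightarrow> 'k" and lam +
  fixes v :: "'f \<Rightarrow> int"
  assumes place: "is_place \<iota> v"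
begin

sublocale const_valuation v \<iota>
  using place by unfold_locales (auto simp: is_place_def)

lemma v_ev: "p \<noteq> 0 \<Longrightarrow> v (tp P) > 0 \<Longrightarrow> v (ev p) = v (tp P) * ord_at P p"
  using v_hom_eval tp_nz by blast

lemma v_y: "v (tp P) > 0 \<Longrightarrow> int m * v y = v (tp P) * ord_at P f"
  using v_ev[OF f_nz, of P] by (simp add: ev_f v_power)

lemma v_Kx_dvd:
  assumes "a \<in> Kx" "a \<noteq> 0" "v (tp P) > 0"
  shows "v (tp P) dvd v a"
proof -
  obtain p q where pq: "q \<noteq> 0" "a * ev q = ev p" using assms(1) unfolding Kx_def by blast
  have p0: "p \<noteq> 0" using pq assms(2) by (metis ev_eq_0_iff no_zero_divisors ev.hom_0)
  have "v a + v (ev q) = v (ev p)" using pq assms(2) by (simp add: v_mult flip: pq(2))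
  hence "v a = v (tp P) * (ord_at P p - ord_at P q)"
    using v_ev[OF p0 assms(3)] v_ev[OF pq(1) assms(3)] by (simp add: algebra_simps)
  thus ?thesis by simp
qed

lemma hom_eval_Kx: "t \<in> Kx \<Longrightarrow> hom_eval \<iota> t p \<in> Kx"
  by (induction p) (simp_all add: Kx_add Kx_mult)

lemma vge_power_diff:
  assumes "vge w 0" "vge b 0" "vge (w - b) n" "n \<ge> 0"
  shows "vge (w ^ j - b ^ j) n"
proof (induction j)
  case (Suc j)
  have b: "vge (b ^ j) 0" for j using assms(2)
  proof (induction j)
    case (Suc j) thus ?case using vge_mult[of b 0 "b ^ j" 0] by simp
  qed (simp add: vge_def)
  have "w ^ Suc j - b ^ Suc j = w * (w ^ j - b ^ j) + (w - b) * b ^ j"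
    by (simp add: algebra_simps)
  thus ?case
    using vge_add[of "w * (w ^ j - b ^ j)" n "(w - b) * b ^ j"]
      vge_mult[OF assms(1) Suc.IH] vge_mult[OF assms(3) b[of j]] by simp
qed simp

text \<open>With c0^g = h(0), the product of all w - \<zeta> c0 has positive value, so one factor
  has. This puts the residue of w into K without prior knowledge of the residue field.\<close>

lemma residue_root:
  assumes t: "t \<noteq> 0" "v t > 0" and h: "poly h 0 \<noteq> 0" and g: "of_nat g \<noteq> (0::'k)"
    and w: "w ^ g = hom_eval \<iota> t h"
  shows "\<exists>c. c ^ g = poly h 0 \<and> vge (w - \<iota> c) 1"
proof -
  have g0: "g > 0" using g by (cases g) auto
  obtain c0 where c0: "c0 ^ g = poly h 0" using alg_closed_root_exists[OF ac g0] by blast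
  interpret e: unital_hom "hom_eval \<iota> t" by (rule \<iota>.hom_eval_unital_hom)
  obtain a h' where h': "h = pCons a h'" by (cases h)
  have vt: "vge t 1" "vge t 0" using t by (auto simp: vge_def)
  have "w ^ g - \<iota> c0 ^ g = t * hom_eval \<iota> t h'"
    using c0 by (simp add: w h' flip: \<iota>.hom_power)
  hence ge1: "vge (w ^ g - \<iota> c0 ^ g) 1"
    using vge_mult[OF vt(1) vge_hom_eval[OF vt(2)], of h'] by simp
  have fac: "w ^ g - \<iota> c0 ^ g = (\<Prod>z\<in>roots_unity g. w - \<iota> z * \<iota> c0)"
    by (rule \<iota>.power_diff_factorization[OF ac g])
  have fin: "finite (roots_unity g :: 'k set)" by (rule roots_unity_factorization(3)[OF ac g])
  have "\<exists>z\<in>roots_unity g. vge (w - \<iota> z * \<iota> c0) 1"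
  proof (rule ccontr)
    assume "\<not> ?thesis"
    hence *: "w - \<iota> z * \<iota> c0 \<noteq> 0 \<and> v (w - \<iota> z * \<iota> c0) \<le> 0" if "z \<in> roots_unity g" for z
      using that by (force simp: vge_def)
    have "(\<Prod>z\<in>roots_unity g. w - \<iota> z * \<iota> c0) \<noteq> 0" using * fin by (simp add: prod_zero_iff)
    moreover have "v (\<Prod>z\<in>roots_unity g. w - \<iota> z * \<iota> c0) \<le> 0"
      using * by (subst v_prod[OF fin]) (auto intro!: sum_nonpos)
    ultimately show False using ge1 unfolding fac vge_def by linarith
  qed
  then obtain z where z: "z ^ g = 1" "vge (w - \<iota> (z * c0)) 1"
    by (auto simp: roots_unity_def \<iota>.hom_mult)
  thus ?thesis using c0 by (intro exI[of _ "z * c0"]) (simp add: power_mult_distrib)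
qed

text \<open>S truncates the power series g-th root of h whose constant term is the residue c of w.
  The product of all w - \<zeta> S(t) has value at least n, and the factors with \<zeta> different
  from 1 are units, so w - S(t) carries the whole value. This replaces passing to a completion of
  F.\<close>

lemma hensel_approximation:
  assumes t: "t \<noteq> 0" "v t > 0" and h: "poly h 0 \<noteq> 0" and g: "of_nat g \<noteq> (0::'k)"
    and w: "w ^ g = hom_eval \<iota> t h" and n: "n \<ge> 1"
  shows "\<exists>S. vge (w - hom_eval \<iota> t S) (int n)"
proof -
  have g0: "g > 0" using g by (cases g) auto
  obtain c where c: "c ^ g = poly h 0" "vge (w - \<iota> c) 1" using residue_root[OF t h g w] by blast
  have c0: "c \<noteq> 0" using c(1) h g0 by (auto simp: zero_power)
  have "c ^ g = fps_of_poly h $ 0" using c(1) by (simp add: poly_0_coeff_0)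
  then obtain T where T: "T ^ g = fps_of_poly h" "T $ 0 = c" using fps_root_exists[OF g _ c0] by blast
  define S where "S = Poly (map (fps_nth T) [0..<n])"
  have coeff_S: "coeff S i = T $ i" if "i < n" for i
    using that by (simp add: S_def nth_default_def)
  have "monom 1 n dvd h - S ^ g"
  proof (subst monom_1_dvd_iff', intro allI impI)
    fix i assume i: "i < n"
    have "(fps_of_poly S ^ g) $ i = (T ^ g) $ i"
    proof (rule fps_power_cong_upto[of i])
      fix j assume "j \<le> i"
      thus "fps_of_poly S $ j = T $ j" using coeff_S[of j] i by simp
    qed (rule order_refl)
    hence "coeff (S ^ g) i = coeff h i" unfolding T(1) fps_of_poly_power[symmetric] by simp
    thus "coeff (h - S ^ g) i = 0" by simp
  qed
  then obtain q where q: "h - S ^ g = monom 1 n * q" by blast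
  interpret e: unital_hom "hom_eval \<iota> t" by (rule \<iota>.hom_eval_unital_hom)
  define s where "s = hom_eval \<iota> t S"
  have vt: "vge t 1" "vge t 0" using t by (auto simp: vge_def)
  have "w ^ g - s ^ g = hom_eval \<iota> t (h - S ^ g)" by (simp add: e.hom_diff e.hom_power w s_def)
  also have "\<dots> = t ^ n * hom_eval \<iota> t q"
    unfolding q e.hom_mult by (simp add: \<iota>.hom_eval_monom \<iota>.hom_1)
  finally have diff: "w ^ g - s ^ g = t ^ n * hom_eval \<iota> t q" .
  have "int n \<le> int n * v t" using t(2) by (simp add: mult_le_cancel_left1)
  hence "vge (t ^ n) (int n)" using t(1) by (simp add: vge_def v_power)
  hence "vge (t ^ n * hom_eval \<iota> t q) (int n + 0)" by (rule vge_mult[OF _ vge_hom_eval[OF vt(2)]])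
  hence ge: "vge (w ^ g - s ^ g) (int n)" by (simp add: diff)
  have sc: "vge (s - \<iota> c) 1"
  proof -
    obtain a S' where S': "S = pCons a S'" by (cases S)
    have "a = c" using coeff_S[of 0] n T(2) by (simp add: S')
    hence "s - \<iota> c = t * hom_eval \<iota> t S'" by (simp add: s_def S')
    thus ?thesis using vge_mult[OF vt(1) vge_hom_eval[OF vt(2)], of S'] by simp
  qed
  \<comment> \<open>Up to elements of positive value, w and s both equal c, so this factor is close
    to the non-zero constant c (1 - z).\<close>
  have unit: "w - \<iota> z * s \<noteq> 0 \<and> v (w - \<iota> z * s) = 0" if z: "z \<noteq> 1" for z
  proof -
    have "vge (\<iota> z * (s - \<iota> c)) 1" using vge_mult[OF vge_const sc, of z] by simp
    hence "vge ((w - \<iota> c) - \<iota> z * (s - \<iota> c)) 1" by (rule vge_diff[OF c(2)])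
    moreover have nz: "\<iota> (c * (1 - z)) \<noteq> 0" and v0: "v (\<iota> (c * (1 - z))) = 0"
      using c0 z v_const[of "c * (1 - z)"] by (simp_all add: \<iota>.hom_eq_0_iff)
    ultimately have "\<iota> (c * (1 - z)) + ((w - \<iota> c) - \<iota> z * (s - \<iota> c)) \<noteq> 0 \<and>
        v (\<iota> (c * (1 - z)) + ((w - \<iota> c) - \<iota> z * (s - \<iota> c))) = 0"
      using v_add_dominant[OF nz, of _ 1] by simp
    moreover have "\<iota> (c * (1 - z)) + ((w - \<iota> c) - \<iota> z * (s - \<iota> c)) = w - \<iota> z * s"
      by (simp add: \<iota>.hom_mult \<iota>.hom_diff \<iota>.hom_1 algebra_simps)
    ultimately show ?thesis by (simp only: simp_thms)
  qed
  have fin: "finite (roots_unity g :: 'k set)" by (rule roots_unity_factorization(3)[OF ac g])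
  define R where "R = (\<Prod>z\<in>roots_unity g - {1}. w - \<iota> z * s)"
  have R0: "R \<noteq> 0" using unit fin unfolding R_def by (simp add: prod_zero_iff)
  have vR: "v R = 0" unfolding R_def
    by (subst v_prod) (use fin unit in \<open>auto intro!: sum.neutral\<close>)
  have one: "1 \<in> (roots_unity g :: 'k set)" by (simp add: roots_unity_def)
  have fac: "w ^ g - s ^ g = (w - s) * R"
    unfolding \<iota>.power_diff_factorization[OF ac g] R_def
    by (subst prod.remove[OF fin one]) (simp add: \<iota>.hom_1)
  have "vge (w - s) (int n)"
  proof (cases "w = s")
    case False
    hence "v ((w - s) * R) = v (w - s)" using v_mult[of "w - s" R] R0 vR by simp
    thus ?thesis using ge False R0 unfolding fac vge_def by simp
  qed simp
  thus ?thesis unfolding s_def by blast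
qed

text \<open>Kummer ramification: modulo a multiple of \<open>v (tp P)\<close>, the values of \<open>v\<close> come from \<open>y\<close>,
  because \<open>y ^ (m div g)\<close> is, up to a power of \<open>tp P\<close>, a \<open>g\<close>-th root of a unit of \<open>K(x)\<close>
  and hence approximated by elements of \<open>K(x)\<close> to any order.\<close>

lemma ramification_index:
  assumes vt: "v (tp P) > 0"
  shows "v (tp P) = int m div gcd (int m) (ord_at P f)"
proof -
  define t where "t = tp P"
  have t: "t \<noteq> 0" "v t > 0" "t \<in> Kx" using vt by (simp_all add: t_def)
  define l where "l = ord_at P f"
  define g where "g = nat (gcd (int m) l)"
  have g: "int g = gcd (int m) l" by (simp add: g_def)
  have g0: "g > 0" using m_pos by (simp add: g_def)
  have "int g dvd int m" unfolding g by simp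
  hence "g dvd m" by simp
  then obtain m' where m': "m = g * m'" by blast
  have m'0: "m' > 0" using m' m_pos by (cases m') auto
  have "int g dvd l" unfolding g by simp
  then obtain l' where l': "l = int g * l'" by blast
  have "int g * int m' = int m" by (simp add: m')
  hence "gcd (int g * int m') (int g * l') = int g" by (simp only: l'[symmetric] g[symmetric])
  hence cop: "coprime (int m') l'"
    using gcd_quotient_eq_1[of "int g" "int m'" l'] g0 by (simp add: coprime_iff_gcd_eq_1)
  have gK: "of_nat g \<noteq> (0::'k)" using m_nz by (auto simp: m')
  obtain h where h: "poly h 0 \<noteq> 0" "y ^ m = t powi l * hom_eval \<iota> t h"
    using \<iota>.local_form[OF tp_nz[of P] f_nz] by (auto simp: ev_f t_def l_def)
  \<comment> \<open>The g-th power of w is y^m stripped of its power of t, hence a polynomial in t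
    with non-zero constant term; so w is a unit to which \<open>hensel_approximation\<close>
    applies.\<close>
  define w where "w = y ^ m' * t powi (- l')"
  have w0: "w \<noteq> 0" using t by (simp add: w_def)
  have ym': "y ^ m' = t powi l' * w" using t by (simp add: w_def power_int_minus)
  have "w ^ g * t powi l = y ^ m"
  proof -
    have "y ^ m = (t powi l' * w) ^ g" unfolding ym'[symmetric] by (simp add: m' mult.commute flip: power_mult)
    also have "\<dots> = w ^ g * t powi l" by (simp add: power_mult_distrib power_int_power' l' mult.commute)
    finally show ?thesis by simp
  qed
  hence wg: "w ^ g = hom_eval \<iota> t h" using h(2) t by (simp add: mult.commute)
  have "int g * v w = 0"
    using v_hom_eval_unit[OF h(1) t(1,2)] v_power[OF w0, of g] by (simp add: wg)
  hence vw: "v w = 0" using g0 by simp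
  have "int m' * v y = v (t powi l' * w)" unfolding ym'[symmetric] by (simp add: v_power)
  also have "\<dots> = l' * v t" using t w0 by (simp add: v_mult v_power_int vw)
  finally have vy': "int m' * v y = l' * v t" .
  hence "int m' dvd l' * v t" by (metis dvd_triv_left)
  hence "int m' dvd v t" using cop by (simp add: coprime_dvd_mult_right_iff)
  \<comment> \<open>The remaining goal is d = 1. It follows once d is seen to divide every value,
    because the value 1 occurs.\<close>
  then obtain d where d: "v t = int m' * d" by blast
  have d0: "d > 0" using t(2) m'0 unfolding d by (simp add: zero_less_mult_iff)
  have vy: "v y = l' * d" using vy' m'0 unfolding d by simp
  have main: "d dvd v z" if z: "z \<noteq> 0" for z
  proof -
    obtain a where a: "\<And>k. a k \<in> Kx" "z = (\<Sum>k<m. a k * y ^ k)" using decomposition by blast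
    define s where "s = t powi l'"
    have s: "s \<in> Kx" using t by (simp add: s_def Kx_power_int)
    have ysw: "y ^ m' = s * w" by (simp add: s_def ym')
    \<comment> \<open>Moves all exponents of y down below m', at the price of powers of w.\<close>
    define b where "b k = a k * y ^ (k mod m') * s ^ (k div m')" for k
    have zk: "a k * y ^ k = b k * w ^ (k div m')" for k
    proof -
      have "y ^ k = y ^ (k mod m' + m' * (k div m'))" by simp
      also have "\<dots> = y ^ (k mod m') * (s * w) ^ (k div m')"
        by (simp only: power_add power_mult ysw)
      finally show ?thesis by (simp add: b_def power_mult_distrib mult_ac)
    qed
    \<comment> \<open>C bounds the values of the non-zero b k from below. The precision n is chosen
      so that replacing w by its approximation A alters z only by something of value above that of
      z.\<close>
    define C where "C = Min ((\<lambda>k. v (b k)) ` {..<m})"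
    have C: "vge (b k) C" if "k < m" for k using that by (auto simp: vge_def C_def intro!: Min_le)
    define n where "n = nat (v z - C) + 1"
    have n: "n \<ge> 1" "C + int n > v z" by (auto simp: n_def)
    obtain S where S: "vge (w - hom_eval \<iota> t S) (int n)"
      using hensel_approximation[OF t(1,2) h(1) gK wg n(1)] by blast
    define A where "A = hom_eval \<iota> t S"
    have A: "A \<in> Kx" using t(3) by (simp add: A_def hom_eval_Kx)
    have vA: "vge A 0" unfolding A_def using t by (intro vge_hom_eval) (simp add: vge_def)
    have vw0: "vge w 0" by (simp add: vge_def vw)
    define z' where "z' = (\<Sum>k<m. b k * A ^ (k div m'))"
    have "vge (b k * (w ^ (k div m') - A ^ (k div m'))) (C + int n)" if "k < m" for k
      by (rule vge_mult[OF C[OF that] vge_power_diff[OF vw0 vA S[folded A_def]]]) simp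
    hence "vge (\<Sum>k<m. b k * (w ^ (k div m') - A ^ (k div m'))) (C + int n)" by (intro vge_sum) simp
    moreover have "(\<Sum>k<m. b k * (w ^ (k div m') - A ^ (k div m'))) = z - z'"
      unfolding a(2) z'_def zk by (simp add: right_diff_distrib sum_subtractf)
    ultimately have "vge (- (z - z')) (C + int n)" by (simp only: vge_minus)
    from v_add_dominant[OF z this n(2)] have z': "z' \<noteq> 0" "v z' = v z" by simp_all
    \<comment> \<open>With A in place of w, everything is a combination of y^c, c < m', over K(x).
      Modulo m' d the terms have values c l' d with l' prime to m', so they are distinct, one term
      attains the value of z', and d divides it.\<close>
    define B where "B c = (\<Sum>k\<in>{k\<in>{..<m}. k mod m' = c}. a k * (s * A) ^ (k div m'))" for c
    have BK: "B c \<in> Kx" for c unfolding B_def by (intro Kx_sum Kx_mult Kx_power a s A)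
    have "z' = (\<Sum>c<m'. \<Sum>k\<in>{k\<in>{..<m}. k mod m' = c}. b k * A ^ (k div m'))"
      unfolding z'_def using m'0 by (intro sum.group[symmetric]) auto
    also have "\<dots> = (\<Sum>c<m'. y ^ c * B c)"
      unfolding B_def sum_distrib_left
      by (intro sum.cong refl) (auto simp: b_def power_mult_distrib mult_ac)
    also have "\<dots> = (\<Sum>c\<in>{c\<in>{..<m'}. B c \<noteq> 0}. y ^ c * B c)"
      by (intro sum.mono_neutral_right) auto
    finally have z'_eq: "z' = (\<Sum>c\<in>{c\<in>{..<m'}. B c \<noteq> 0}. y ^ c * B c)" .
    have val: "\<exists>q. v (y ^ c * B c) = (int c * l' + int m' * q) * d" if Bc: "B c \<noteq> 0" for c
    proof -
      obtain q where "v (B c) = v t * q"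
        using v_Kx_dvd[OF BK Bc vt] unfolding t_def by blast
      thus ?thesis using Bc by (intro exI[of _ q]) (simp add: v_mult v_power vy d algebra_simps)
    qed
    have inj: "inj_on (\<lambda>c. v (y ^ c * B c)) {c\<in>{..<m'}. B c \<noteq> 0}"
    proof (rule inj_onI)
      fix c c' assume cc: "c \<in> {c\<in>{..<m'}. B c \<noteq> 0}" "c' \<in> {c\<in>{..<m'}. B c \<noteq> 0}"
        and eq: "v (y ^ c * B c) = v (y ^ c' * B c')"
      obtain q q' where "v (y ^ c * B c) = (int c * l' + int m' * q) * d"
        "v (y ^ c' * B c') = (int c' * l' + int m' * q') * d" using val cc by blast
      with eq d0 have "int c * l' + int m' * q = int c' * l' + int m' * q'" by simp
      hence "(int c - int c') * l' = int m' * (q' - q)" by (simp add: algebra_simps)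
      hence "int m' dvd (int c - int c') * l'" by simp
      hence "int m' dvd int c - int c'" using cop by (simp add: coprime_dvd_mult_left_iff)
      hence "int c mod int m' = int c' mod int m'" by (simp add: mod_eq_dvd_iff)
      thus "c = c'" using cc by simp
    qed
    have ne: "{c\<in>{..<m'}. B c \<noteq> 0} \<noteq> {}"
    proof
      assume "{c\<in>{..<m'}. B c \<noteq> 0} = {}"
      hence "z' = 0" unfolding z'_eq by simp
      thus False using z' by simp
    qed
    obtain c where c: "B c \<noteq> 0" "v z' = v (y ^ c * B c)"
      using v_sum_distinct[OF _ ne _ inj] unfolding z'_eq by force
    obtain q where "v (y ^ c * B c) = (int c * l' + int m' * q) * d" using val[OF c(1)] by blast
    thus ?thesis using c(2) z'(2) by simp
  qed
  obtain z where "z \<noteq> 0" "v z = 1" using place unfolding is_place_def by blast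
  hence "d = 1" using main[of z] d0 by simp
  hence "v t = int m'" using d by simp
  also have "\<dots> = int m div int g" using g0 by (simp add: m')
  finally show ?thesis by (simp add: t_def g l_def)
qed

end

section \<open>Dimension and degree counts\<close>

text \<open>Triviality of all relations over the index set includes injectivity of b, so the index
  set can be counted in place of the set of vectors.\<close>

lemma (in vector_space) dim_eq_card_family:
  assumes I: "finite I" and indep: "\<And>c i. (\<Sum>i\<in>I. scale (c i) (b i)) = 0 \<Longrightarrow> i \<in> I \<Longrightarrow> c i = 0"
    and V: "V = {(\<Sum>i\<in>I. scale (c i) (b i)) | c. True}"
  shows "dim V = card I"
proof -
  have inj: "inj_on b I"
  proof (rule inj_onI, rule ccontr)
    fix i j assume ij: "i \<in> I" "j \<in> I" "b i = b j" "i \<noteq> j"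
    \<comment> \<open>If b i = b j, this difference of two indicators is a non-trivial
      relation.\<close>
    define c where "c k = (if k = i then 1 else 0) - (if k = j then 1 else 0 :: 'a)" for k
    have c: "scale (c k) (b k) = (if k = i then b i else 0) - (if k = j then b j else 0)" for k
      by (simp add: c_def scale_left_diff_distrib)
    have "(\<Sum>k\<in>I. scale (c k) (b k)) = 0"
      unfolding c sum_subtractf using I ij by simp
    from indep[OF this ij(1)] show False using ij by (simp add: c_def)
  qed
  have ind: "independent (b ` I)"
  proof (rule independent_if_scalars_zero)
    fix c z assume 0: "(\<Sum>z\<in>b ` I. scale (c z) z) = 0" and "z \<in> b ` I"
    then obtain i where i: "i \<in> I" "z = b i" by blast
    have "(\<Sum>i\<in>I. scale (c (b i)) (b i)) = 0" using 0 by (simp add: sum.reindex[OF inj])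
    from indep[OF this i(1)] show "c z = 0" by (simp add: i)
  qed (use I in simp)
  have "b i \<in> V" if "i \<in> I" for i
  proof -
    have "scale (if k = i then 1 else 0) (b k) = (if k = i then b i else 0)" for k by simp
    hence "(\<Sum>k\<in>I. scale (if k = i then 1 else 0) (b k)) = b i" using that I by simp
    thus ?thesis
      unfolding V by (intro CollectI exI[of _ "\<lambda>k. if k = i then 1 else 0"]) (simp only: simp_thms)
  qed
  hence "b ` I \<subseteq> span V" using span_superset by blast
  moreover have "V \<subseteq> span (b ` I)"
    unfolding V by clarify (rule span_sum, rule span_scale, rule span_base, rule imageI)
  ultimately have "span (b ` I) = span V" by (simp add: span_eq)
  hence "dim V = card (b ` I)" using ind by (rule dim_eq_card)
  also have "\<dots> = card I" by (rule card_image[OF inj])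
  finally show ?thesis .
qed

section \<open>Floors, congruences and the count of exponents\<close>

lemma div_diff_pred:
  fixes a n :: int
  assumes "n > 0"
  shows "a div n - (a - 1) div n = (if n dvd a then 1 else 0)"
proof (cases "n dvd a")
  case True
  then obtain c where a: "a = n * c" by blast
  have "(a - 1) div n = (n - 1 + (c - 1) * n) div n" by (simp add: a algebra_simps)
  also have "\<dots> = c - 1" using assms by (subst div_mult_self1) auto
  finally show ?thesis using a assms by simp
next
  case False
  hence "a mod n \<noteq> 0" by (simp add: dvd_eq_mod_eq_0)
  hence r: "a mod n \<ge> 1" using assms pos_mod_sign[OF assms, of a] by linarith
  have "(a - 1) div n = (a mod n - 1 + (a div n) * n) div n"
    by (simp add: algebra_simps)
  also have "\<dots> = a div n + (a mod n - 1) div n" using assms by (subst div_mult_self1) auto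
  also have "(a mod n - 1) div n = 0"
    using r pos_mod_bound[OF assms, of a] by (intro div_pos_pos_trivial) linarith+
  finally show ?thesis using False by simp
qed

lemma frac_of_int_div:
  assumes "m > 0"
  shows "frac (real_of_int a / real m) = real_of_int (a mod int m) / real m"
proof -
  have "\<lfloor>real_of_int a / real m\<rfloor> = a div int m"
    using floor_divide_of_int_eq[of a "int m", where 'a = real] by simp
  moreover have "real_of_int a = real_of_int (a div int m) * real m + real_of_int (a mod int m)"
    by (metis div_mult_mod_eq of_int_add of_int_mult of_int_of_nat_eq)
  ultimately show ?thesis using assms by (simp add: frac_def field_simps)
qed

text \<open>Its negative is the least order that the coefficient of y^k may have at point i. The
  summand s gcd(m, L u) is s divided by the ramification index m / gcd(m, L u) and scaled by
  m.\<close>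

definition floor_exp :: "nat \<Rightarrow> (nat \<Rightarrow> int) \<Rightarrow> nat \<Rightarrow> int \<Rightarrow> int \<Rightarrow> nat \<Rightarrow> int" where
  "floor_exp m L u k s i = (k * L i + (if i = u then s * gcd (int m) (L u) else 0)) div int m"

text \<open>Degree of the divisor on the projective line that constrains the coefficient of y^k. The
  corresponding summand has dimension one more, or 0 if this is negative.\<close>

definition deg_bound :: "nat \<Rightarrow> nat \<Rightarrow> (nat \<Rightarrow> int) \<Rightarrow> nat \<Rightarrow> int \<Rightarrow> int \<Rightarrow> int" where
  "deg_bound m r L u k s = (\<Sum>i=0..r+1. floor_exp m L u k s i)"

lemma linear_congruence_ex1:
  fixes n l s :: int
  assumes n0: "n > 0" and cop: "coprime n l"
  shows "\<exists>!t. 0 \<le> t \<and> t < n \<and> (s + l * t) mod n = 0"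
proof (rule ex_ex1I)
  have "gcd n l = 1" using cop by (simp only: coprime_iff_gcd_eq_1)
  \<comment> \<open>b inverts l modulo n, so -s b solves the congruence.\<close>
  then obtain a b where ab: "a * n + b * l = 1" using bezout_int[of n l] by (elim exE) (simp only:)
  have "s + l * ((- s * b) mod n) = s + l * (- s * b - n * ((- s * b) div n))"
    by (simp only: minus_mult_div_eq_mod)
  also have "\<dots> = s * 1 - s * b * l - n * (l * ((- s * b) div n))"
    by (simp add: algebra_simps)
  also have "\<dots> = n * (s * a - l * ((- s * b) div n))" unfolding ab[symmetric] by (simp add: algebra_simps)
  finally have "(s + l * ((- s * b) mod n)) mod n = 0" by (simp only: mod_mult_self1_is_0)
  thus "\<exists>t. 0 \<le> t \<and> t < n \<and> (s + l * t) mod n = 0" using n0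
    by (intro exI[of _ "(- s * b) mod n"] conjI pos_mod_sign pos_mod_bound)
next
  fix t t' assume t: "0 \<le> t \<and> t < n \<and> (s + l * t) mod n = 0" and t': "0 \<le> t' \<and> t' < n \<and> (s + l * t') mod n = 0"
  hence "n dvd s + l * t" "n dvd s + l * t'" by (simp_all only: dvd_eq_mod_eq_0)
  hence "n dvd (s + l * t) - (s + l * t')" by (rule dvd_diff)
  also have "(s + l * t) - (s + l * t') = l * (t - t')" by (simp add: algebra_simps)
  finally have "n dvd t - t'" using cop by (simp add: coprime_dvd_mult_right_iff)
  hence "t mod n = t' mod n" by (simp add: mod_eq_dvd_iff)
  thus "t = t'" using t t' by simp
qed

lemma t_u_props:
  assumes m: "m > 0"
  shows "0 \<le> t_u m l s" "t_u m l s < m_u m l" "m_u m l dvd s + (l div gcd (int m) l) * t_u m l s"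
proof -
  let ?g = "gcd (int m) l" and ?l = "l div gcd (int m) l"
  let ?m = "m_u m l"
  have g0: "?g > 0" using m by simp
  have gm: "?g * ?m = int m" by (simp add: m_u_def)
  have m0: "?m > 0" using gm g0 m by (metis of_nat_0_less_iff zero_less_mult_pos)
  have cop: "coprime ?m ?l"
    using div_gcd_coprime[of "int m" l] m by (simp add: m_u_def)
  from theI'[OF linear_congruence_ex1[OF m0 cop, of s]]
  have "0 \<le> t_u m l s \<and> t_u m l s < ?m \<and> (s + ?l * t_u m l s) mod ?m = 0" unfolding t_u_def .
  thus "0 \<le> t_u m l s" "t_u m l s < ?m" "?m dvd s + ?l * t_u m l s" by (simp_all only: dvd_eq_mod_eq_0)
qed

context
  fixes m r u :: nat and L :: "nat \<Rightarrow> int" and s :: int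
  assumes m: "m > 0" and u: "u \<le> r + 1" and L: "(\<Sum>i=0..r+1. L i) = 0"
begin

lemma m_u_facts:
  shows "gcd (int m) (L u) * m_u m (L u) = int m" "m_u m (L u) > 0" "gcd (int m) (L u) > 0"
    and "coprime (m_u m (L u)) (L u div gcd (int m) (L u))"
proof -
  show g0: "gcd (int m) (L u) > 0" using m by simp
  show gm: "gcd (int m) (L u) * m_u m (L u) = int m" by (simp add: m_u_def)
  show "m_u m (L u) > 0" using gm g0 m by (metis of_nat_0_less_iff zero_less_mult_pos)
  show "coprime (m_u m (L u)) (L u div gcd (int m) (L u))"
    using div_gcd_coprime[of "int m" "L u"] m by (simp add: m_u_def)
qed

lemma floor_exp_u: "floor_exp m L u k s u = (k * (L u div gcd (int m) (L u)) + s) div m_u m (L u)"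
proof -
  let ?g = "gcd (int m) (L u)"
  have "k * L u + s * ?g = ?g * (k * (L u div ?g) + s)"
    by (simp add: algebra_simps)
  hence "floor_exp m L u k s u = (?g * (k * (L u div ?g) + s)) div (?g * m_u m (L u))"
    by (simp only: floor_exp_def if_True simp_thms m_u_facts(1))
  also have "\<dots> = (k * (L u div ?g) + s) div m_u m (L u)"
    using m_u_facts(3) by (intro div_mult_mult1) simp
  finally show ?thesis .
qed

lemma deg_bound_remove:
  "deg_bound m r L u k s = (\<Sum>i\<in>{0..r+1}-{u}. (k * L i) div int m) + floor_exp m L u k s u"
proof -
  have "deg_bound m r L u k s = floor_exp m L u k s u + (\<Sum>i\<in>{0..r+1}-{u}. floor_exp m L u k s i)"
    unfolding deg_bound_def using u by (intro sum.remove) auto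
  also have "(\<Sum>i\<in>{0..r+1}-{u}. floor_exp m L u k s i) = (\<Sum>i\<in>{0..r+1}-{u}. (k * L i) div int m)"
    by (intro sum.cong) (auto simp: floor_exp_def)
  finally show ?thesis by simp
qed

text \<open>The congruence makes the u-th floor exact. As the L i add up to 0, m times the bound
  equals m c minus the residues of all k L i modulo m, where c is the ceiling of s / m_u. The
  residue at infinity is below m, so it cannot decide the sign of a multiple of m: this is why the
  sum of fractional parts stops at r.\<close>

lemma deg_bound_nonneg_iff:
  assumes k: "m_u m (L u) dvd s + (L u div gcd (int m) (L u)) * k"
  shows "deg_bound m r L u k s \<ge> 0 \<longleftrightarrow>
    (\<Sum>i=0..r. frac (real_of_int (k * L i) / real m))
       \<le> 1 + real_of_int \<lfloor>real_of_int (s - 1) / real_of_int (m_u m (L u))\<rfloor>"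
proof -
  let ?g = "gcd (int m) (L u)" and ?l = "L u div gcd (int m) (L u)" and ?m = "m_u m (L u)"
  define c where "c = 1 + (s - 1) div ?m"
  define A where "A = (\<Sum>i=0..r. (k * L i) mod int m)"
  define \<tau> where "\<tau> = (k * L (r+1)) mod int m"
  obtain q where q: "s + ?l * k = ?m * q" using k by blast
  have 1: "floor_exp m L u k s u = q"
    unfolding floor_exp_u using m_u_facts(2) q by (simp add: algebra_simps)
  have "(k * L u) div int m = (?g * (k * ?l)) div (?g * ?m)"
    by (simp only: m_u_facts(1)) (simp add: algebra_simps)
  also have "\<dots> = (k * ?l) div ?m" using m_u_facts(3) by (intro div_mult_mult1) simp
  also have "k * ?l = - s + q * ?m" using q by (simp add: algebra_simps)
  also have "(- s + q * ?m) div ?m = q + (- s) div ?m" using m_u_facts(2) by (subst div_mult_self1) auto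
  \<comment> \<open>The floor of -s / m_u is minus the ceiling of s / m_u, and that ceiling is 1 +
    (s - 1) div m_u.\<close>
  also have "(- s) div ?m = - c"
  proof -
    have "s - 1 = (c - 1) * ?m + (s - 1) mod ?m"
      by (simp only: c_def add_diff_cancel_left' div_mult_mod_eq)
    hence "- s = (?m - 1 - (s - 1) mod ?m) + (- c) * ?m" by (simp add: algebra_simps)
    hence "(- s) div ?m = ((?m - 1 - (s - 1) mod ?m) + (- c) * ?m) div ?m" by (rule arg_cong)
    also have "\<dots> = - c + (?m - 1 - (s - 1) mod ?m) div ?m"
      using m_u_facts(2) by (intro div_mult_self1) simp
    also have "(?m - 1 - (s - 1) mod ?m) div ?m = 0"
      using pos_mod_bound[OF m_u_facts(2), of "s - 1"] pos_mod_sign[OF m_u_facts(2), of "s - 1"]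
      by (intro div_pos_pos_trivial) linarith+
    finally show ?thesis by simp
  qed
  finally have 2: "(k * L u) div int m = q - c" by simp
  have "(\<Sum>i=0..r+1. (k * L i) div int m) = (k * L u) div int m + (\<Sum>i\<in>{0..r+1}-{u}. (k * L i) div int m)"
    using u by (intro sum.remove) auto
  hence D: "deg_bound m r L u k s = (\<Sum>i=0..r+1. (k * L i) div int m) + c"
    unfolding deg_bound_remove 1 2 by simp
  have "int m * (\<Sum>i=0..r+1. (k * L i) div int m) = (\<Sum>i=0..r+1. k * L i - (k * L i) mod int m)"
    unfolding sum_distrib_left by (intro sum.cong refl) (simp add: minus_mod_eq_mult_div)
  also have "\<dots> = k * (\<Sum>i=0..r+1. L i) - (\<Sum>i=0..r+1. (k * L i) mod int m)"
    by (simp only: sum_subtractf sum_distrib_left)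
  also have "\<dots> = - (A + \<tau>)" unfolding L by (simp add: A_def \<tau>_def)
  finally have E: "int m * deg_bound m r L u k s = int m * c - (A + \<tau>)"
    unfolding D by (simp add: algebra_simps)
  have \<tau>: "0 \<le> \<tau>" "\<tau> < int m" using m by (simp_all add: \<tau>_def)
  have "deg_bound m r L u k s \<ge> 0 \<longleftrightarrow> A \<le> int m * c"
  proof
    assume "deg_bound m r L u k s \<ge> 0"
    hence "int m * deg_bound m r L u k s \<ge> 0" by simp
    thus "A \<le> int m * c" using E \<tau> by linarith
  next
    assume "A \<le> int m * c"
    hence "int m * deg_bound m r L u k s > int m * (- 1)" using E \<tau> by linarith
    hence "deg_bound m r L u k s > - 1" using m by (simp only: mult_less_cancel_left_pos of_nat_0_less_iff)
    thus "deg_bound m r L u k s \<ge> 0" by simp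
  qed
  also have "\<dots> \<longleftrightarrow> real_of_int A / real m \<le> real_of_int c"
  proof -
    have "A \<le> int m * c \<longleftrightarrow> real_of_int A \<le> real_of_int (int m * c)" by (simp only: of_int_le_iff)
    also have "\<dots> \<longleftrightarrow> real_of_int A / real m \<le> real_of_int c" using m by (simp add: field_simps)
    finally show ?thesis .
  qed
  also have "real_of_int A / real m = (\<Sum>i=0..r. frac (real_of_int (k * L i) / real m))"
    unfolding A_def frac_of_int_div[OF m] by (simp add: sum_divide_distrib)
  also have "real_of_int c = 1 + real_of_int \<lfloor>real_of_int (s - 1) / real_of_int ?m\<rfloor>"
    unfolding c_def floor_divide_of_int_eq by simp
  finally show ?thesis .
qed

end

text \<open>The k in 0, ..., m - 1 satisfying the congruence are t_u + j m_u with 0 <= j < gcd(m, L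
  u), which matches them with the j that are counted.\<close>

lemma deg_bound_count:
  fixes m r u :: nat and L :: "nat \<Rightarrow> int" and s :: int
  assumes m: "m > 0" and u: "u \<le> r + 1" and L: "(\<Sum>i=0..r+1. L i) = 0"
  shows "(\<Sum>k<m. int (nat (deg_bound m r L u (int k) s + 1))) -
         (\<Sum>k<m. int (nat (deg_bound m r L u (int k) (s - 1) + 1))) =
         int (card {j \<in> {0..<gcd (int m) (L u)}.
            (\<Sum>i=0..r. frac (real_of_int ((t_u m (L u) s + j * m_u m (L u)) * L i) / real m))
              \<le> 1 + real_of_int \<lfloor>real_of_int (s - 1) / real_of_int (m_u m (L u))\<rfloor>})"
proof -
  let ?g = "gcd (int m) (L u)" and ?l = "L u div gcd (int m) (L u)" and ?m = "m_u m (L u)"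
  let ?D = "\<lambda>k s. deg_bound m r L u k s"
  let ?t = "t_u m (L u) s"
  note facts = m_u_facts[OF m u L] and t = t_u_props[OF m, of "L u" s]
  define J where "J = {j \<in> {0..<?g}. ?D (?t + j * ?m) s \<ge> 0}"
  have dvd: "?m dvd s + ?l * (?t + j * ?m)" for j
  proof -
    have eq: "s + ?l * (?t + j * ?m) = (s + ?l * ?t) + ?m * (?l * j)" by (simp add: algebra_simps)
    show ?thesis unfolding eq using t(3) by (rule dvd_add) simp
  qed
  have J: "{j \<in> {0..<?g}. (\<Sum>i=0..r. frac (real_of_int ((?t + j * ?m) * L i) / real m))
              \<le> 1 + real_of_int \<lfloor>real_of_int (s - 1) / real_of_int ?m\<rfloor>} = J"
    unfolding J_def deg_bound_nonneg_iff[OF m u L dvd] ..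
  have diff: "?D k s - ?D k (s - 1) = (if ?m dvd s + ?l * k then 1 else 0)" for k
    unfolding deg_bound_remove[OF m u L] floor_exp_u[OF m u L]
    using div_diff_pred[OF facts(2), of "k * ?l + s"] by (simp add: algebra_simps)
  \<comment> \<open>A bound rising from below -1 contributes dimension 0 before and after, so the
    increment is visible only when the new bound is nonnegative.\<close>
  have step: "int (nat (?D k s + 1)) - int (nat (?D k (s - 1) + 1)) = (if ?m dvd s + ?l * k \<and> ?D k s \<ge> 0 then 1 else 0)" for k
    using diff[of k] by (auto split: if_splits)
  let ?K = "{k \<in> {..<m}. ?m dvd s + ?l * int k \<and> ?D (int k) s \<ge> 0}"
  have "(\<Sum>k<m. int (nat (?D (int k) s + 1))) - (\<Sum>k<m. int (nat (?D (int k) (s - 1) + 1)))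
     = (\<Sum>k<m. if ?m dvd s + ?l * int k \<and> ?D (int k) s \<ge> 0 then 1 else 0)"
    unfolding sum_subtractf[symmetric] step ..
  also have "\<dots> = int (card ?K)" by (simp add: sum.If_cases Int_def)
  also have "card ?K = card J"
  proof (rule bij_betw_same_card[symmetric])
    have nonneg: "?t + j * ?m \<ge> 0" if "j \<ge> 0" for j using that t facts(2) by simp
    show "bij_betw (\<lambda>j. nat (?t + j * ?m)) J ?K"
    proof (rule bij_betwI')
      fix i j assume "i \<in> J" "j \<in> J"
      thus "nat (?t + i * ?m) = nat (?t + j * ?m) \<longleftrightarrow> i = j"
        using nonneg[of i] nonneg[of j] facts(2) by (auto simp: J_def nat_eq_iff2)
    next
      fix j assume j: "j \<in> J"
      hence "j + 1 \<le> ?g" "j \<ge> 0" by (auto simp: J_def)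
      hence "(j + 1) * ?m \<le> ?g * ?m" using facts(2) by (intro mult_right_mono) auto
      hence "?t + j * ?m < int m" unfolding facts(1) using t(2) by (simp add: algebra_simps)
      thus "nat (?t + j * ?m) \<in> ?K" using j dvd[of j] nonneg[of j] by (auto simp: J_def nat_less_iff)
    next
      fix k assume k: "k \<in> ?K"
      have "?m dvd (s + ?l * int k) - (s + ?l * ?t)" using k t(3) by (intro dvd_diff) auto
      hence "?m dvd ?l * (int k - ?t)" by (simp add: algebra_simps)
      hence "?m dvd int k - ?t" using facts(4) by (simp add: coprime_dvd_mult_right_iff)
      then obtain j where "int k - ?t = ?m * j" by (rule dvdE)
      hence j: "int k = ?t + j * ?m" by (simp add: algebra_simps)
      \<comment> \<open>t_u < m_u excludes negative j; k < m excludes j beyond the gcd.\<close>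
      have "j * ?m > (- 1) * ?m" using j t(2) by linarith
      hence "j > - 1" using facts(2) by (simp only: mult_less_cancel_right_pos)
      hence j0: "j \<ge> 0" by simp
      have "j * ?m < ?g * ?m" unfolding facts(1) using j t(1) k by (auto simp: algebra_simps)
      hence "j < ?g" using facts(2) by (simp only: mult_less_cancel_right_pos)
      hence "j \<in> J" using j0 k j by (auto simp: J_def)
      moreover have "k = nat (?t + j * ?m)" unfolding j[symmetric] by simp
      ultimately show "\<exists>j\<in>J. k = nat (?t + j * ?m)" by blast
    qed
  qed
  finally show ?thesis unfolding J .
qed

section \<open>Riemann-Roch spaces of fibres\<close>

lemma order_linear_power: "order b ([:- a, 1:] ^ n :: 'k::field poly) = (if a = b then n else 0)"
proof (cases "a = b")
  case False
  hence "poly ([:- a, 1:] ^ n) b \<noteq> 0" by simp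
  from order_0I[OF this] show ?thesis using False by (simp only: if_False)
qed (simp only: order_power_n_n refl if_True)

lemma order_prod_linear_powers:
  fixes c :: "'i \<Rightarrow> 'k::field"
  assumes "finite A"
  shows "order b (\<Prod>i\<in>A. [:- c i, 1:] ^ e i) = (\<Sum>i\<in>A. if c i = b then e i else 0)"
  using assms
proof (induction A rule: finite_induct)
  case (insert a A)
  have "(\<Prod>i\<in>A. [:- c i, 1:] ^ e i) \<noteq> 0" using insert.hyps by (auto simp: prod_zero_iff)
  hence "[:- c a, 1:] ^ e a * (\<Prod>i\<in>A. [:- c i, 1:] ^ e i) \<noteq> 0" by simp
  from order_mult[OF this, of b] show ?case
    unfolding prod.insert[OF insert.hyps] sum.insert[OF insert.hyps] order_linear_power insert.IH .
qed simp

lemma degree_prod_linear_powers: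
  fixes c :: "'i \<Rightarrow> 'k::field"
  shows "degree (\<Prod>i\<in>A. [:- c i, 1:] ^ e i) = (\<Sum>i\<in>A. e i)"
  by (subst degree_prod_sum_eq) (auto simp: degree_linear_power)

lemma sum_if_inj:
  assumes "inj_on c A" "j \<in> A" "finite A"
  shows "(\<Sum>i\<in>A. if c i = c j then g i else 0) = g j"
proof -
  have "(\<Sum>i\<in>A. if c i = c j then g i else 0) = (\<Sum>i\<in>A. if i = j then g i else 0)"
    using assms by (intro sum.cong) (auto simp: inj_on_def)
  thus ?thesis using assms by simp
qed

lemma ord_at_linear: "ord_at P [:- a, 1:] = (case P of Some b \<Rightarrow> if a = b then 1 else 0 | None \<Rightarrow> - 1)"
  using order_linear_power[of _ a 1] by (simp add: ord_at_def split: option.split)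

text \<open>Two distinct finite points would give the non-zero constant \<iota> (b - c) positive
  value; a finite point makes x integral, whereas infinity makes it a pole.\<close>

lemma (in kummer_place) lies_over_unique:
  assumes "v (tp P) > 0" "v (tp Q) > 0"
  shows "P = Q"
proof -
  have no: False if "v (tp (Some b)) > 0" "v (tp None) > 0" for b
  proof -
    have "vge (x - \<iota> b) 0" using that(1) by (simp add: vge_def loc_param_def)
    hence "vge (x - \<iota> b + \<iota> b) 0" by (intro vge_add vge_const)
    hence "v x \<ge> 0" by (simp add: vge_def)
    thus False using that(2) by (simp add: loc_param_def v_inverse)
  qed
  have eq: "b = c" if "v (tp (Some b)) > 0" "v (tp (Some c)) > 0" for b c
  proof (rule ccontr)
    assume "b \<noteq> c"
    hence "\<iota> (b - c) \<noteq> 0" "v (\<iota> (b - c)) = 0" using v_const[of "b - c"] by (simp_all add: \<iota>.hom_eq_0_iff)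
    moreover have "vge (x - \<iota> c) 1" "vge (x - \<iota> b) 1" using that by (simp_all add: vge_def loc_param_def)
    hence "vge ((x - \<iota> c) - (x - \<iota> b)) 1" by (rule vge_diff)
    moreover have "(x - \<iota> c) - (x - \<iota> b) = \<iota> (b - c)" by (simp add: \<iota>.hom_diff)
    ultimately show False by (simp add: vge_def)
  qed
  show ?thesis using assms no eq by (cases P; cases Q) auto
qed

section \<open>The points of the statement and the divisor of f\<close>

locale kummer_point = kummer \<iota> x y m r \<alpha> lam
  for \<iota> :: "'k::field \<Rightarrow> 'f::field" and x y and m r :: nat and \<alpha> :: "nat \<Rightarrow> 'k" and lam +
  fixes \<alpha>0 :: 'k and u :: nat
  assumes \<alpha>0: "\<alpha>0 \<notin> \<alpha> ` {1..r}" and u: "u \<le> r + 1"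
begin

abbreviation pt :: "nat \<Rightarrow> 'k option" where "pt \<equiv> pt_ext \<alpha> \<alpha>0 r"
abbreviation L :: "nat \<Rightarrow> int" where "L \<equiv> lam_ext lam r"
abbreviation fe :: "nat \<Rightarrow> int \<Rightarrow> nat \<Rightarrow> int" where "fe k \<equiv> floor_exp m L u (int k)"
abbreviation db :: "nat \<Rightarrow> int \<Rightarrow> int" where "db k \<equiv> deg_bound m r L u (int k)"

text \<open>Merges \<alpha>0 with the roots of f so that all finite points 0, ..., r are treated
  alike.\<close>

definition \<beta> :: "nat \<Rightarrow> 'k" where "\<beta> i = (if i = 0 then \<alpha>0 else \<alpha> i)"

lemma pt_le: "i \<le> r \<Longrightarrow> pt i = Some (\<beta> i)"
  by (simp add: pt_ext_def \<beta>_def)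

lemma pt_last: "pt (Suc r) = None"
  by (simp add: pt_ext_def)

lemma inj_\<beta>: "inj_on \<beta> {0..r}"
proof (rule inj_onI)
  fix i j assume ij: "i \<in> {0..r}" "j \<in> {0..r}" "\<beta> i = \<beta> j"
  have ne: "\<alpha> k \<noteq> \<alpha>0" if "k \<in> {0..r}" "k \<noteq> 0" for k
    using \<alpha>0 that by (metis One_nat_def Suc_le_eq atLeastAtMost_iff imageI not_gr_zero)
  consider "i = 0" "j = 0" | "i = 0" "j \<noteq> 0" | "i \<noteq> 0" "j = 0" | "i \<noteq> 0" "j \<noteq> 0" by blast
  thus "i = j"
  proof cases
    case 2 thus ?thesis using ij ne[of j] by (simp add: \<beta>_def)
  next
    case 3 thus ?thesis using ij ne[of i] by (simp add: \<beta>_def)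
  next
    case 4 thus ?thesis using ij inj_onD[OF inj_alpha, of i j] by (simp add: \<beta>_def)
  qed simp
qed

lemma ord_at_f_Some: "ord_at (Some b) f = (\<Sum>i=1..r. if \<alpha> i = b then int (lam i) else 0)"
  unfolding ord_at_def f_def option.case order_prod_linear_powers[OF finite_atLeastAtMost]
  by (simp add: if_distrib[of int] cong: if_cong)

text \<open>Identifies \<open>lam_ext\<close> with the divisor of f: \<alpha>0 is not a root, the
  other finite points are distinct, and the order at infinity is minus the degree.\<close>

lemma ord_at_pt_f:
  assumes "i \<le> r + 1"
  shows "ord_at (pt i) f = L i"
proof -
  consider "i = 0" | "i \<noteq> 0" "i \<le> r" | "i = Suc r" using assms by linarith
  thus ?thesis
  proof cases
    case 1
    have "ord_at (Some \<alpha>0) f = 0" unfolding ord_at_f_Some using \<alpha>0 by (intro sum.neutral) auto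
    thus ?thesis using 1 by (simp add: pt_ext_def lam_ext_def)
  next
    case 2
    hence i: "i \<in> {1..r}" by simp
    show ?thesis using 2 sum_if_inj[OF inj_alpha i finite_atLeastAtMost, of "\<lambda>i. int (lam i)"]
      by (simp add: pt_ext_def lam_ext_def ord_at_f_Some)
  next
    case 3
    thus ?thesis by (simp add: pt_ext_def lam_ext_def ord_at_def f_def degree_prod_linear_powers)
  qed
qed

lemma ord_at_f_other: "b \<notin> \<beta> ` {0..r} \<Longrightarrow> ord_at (Some b) f = 0"
  unfolding ord_at_f_Some by (intro sum.neutral) (auto simp: \<beta>_def image_iff)

lemma L_sum: "(\<Sum>i=0..r+1. L i) = 0"
proof -
  have "(\<Sum>i=0..r+1. L i) = L 0 + (\<Sum>i=1..r. L i) + L (Suc r)"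
    by (simp add: sum.atLeast_Suc_atMost)
  also have "(\<Sum>i=1..r. L i) = (\<Sum>i=1..r. int (lam i))" by (intro sum.cong) (auto simp: lam_ext_def)
  finally show ?thesis by (simp add: lam_ext_def)
qed

lemma point_cases:
  obtains (pt) i where "i \<le> r + 1" "P = pt i" | (other) b where "P = Some b" "b \<notin> \<beta> ` {0..r}"
proof (cases P)
  case None
  thus ?thesis using pt[of "Suc r"] by (simp add: pt_last)
next
  case (Some b)
  show ?thesis
  proof (cases "b \<in> \<beta> ` {0..r}")
    case True
    then obtain i where "i \<le> r" "b = \<beta> i" by auto
    thus ?thesis using pt[of i] Some by (simp add: pt_le)
  qed (use other Some in blast)
qed

text \<open>Has the least permitted order at each finite point 0, ..., r. What stays free is a
  polynomial factor, whose degree is limited by the condition at infinity.\<close>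

definition gk :: "nat \<Rightarrow> int \<Rightarrow> 'f" where
  "gk k s = (\<Prod>i=0..r. (x - \<iota> (\<beta> i)) powi (- fe k s i))"

lemma gk_nz [simp]: "gk k s \<noteq> 0"
  by (simp add: gk_def prod_zero_iff del: right_minus_eq)

lemma gk_Kx [simp]: "gk k s \<in> Kx"
  unfolding gk_def by (intro Kx_prod Kx_power_int Kx_linear)

lemma db_split: "db k s = (\<Sum>i=0..r. fe k s i) + fe k s (Suc r)"
  by (simp add: deg_bound_def)

text \<open>The divisor of \<open>gk k s * p(x)\<close> dominates the floors of the required exponents at the
  points \<open>pt i\<close>, with the degree condition on \<open>p\<close> accounting for the point at infinity.\<close>

lemma ord_gk_poly:
  assumes "p \<noteq> 0" "int (degree p) \<le> db k s"
  defines "D \<equiv> \<lambda>P. (\<Sum>i=0..r. - fe k s i * ord_at P [:- \<beta> i, 1:]) + ord_at P p"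
  shows "i \<le> r + 1 \<Longrightarrow> D (pt i) \<ge> - fe k s i" and "b \<notin> \<beta> ` {0..r} \<Longrightarrow> D (Some b) \<ge> 0"
proof -
  have some: "(\<Sum>i=0..r. - fe k s i * ord_at (Some b) [:- \<beta> i, 1:])
      = (\<Sum>i=0..r. if \<beta> i = b then - fe k s i else 0)" for b
    by (intro sum.cong) (auto simp: ord_at_linear)
  show "D (pt i) \<ge> - fe k s i" if "i \<le> r + 1"
  proof (cases "i = Suc r")
    case True
    have "(\<Sum>i=0..r. - fe k s i * ord_at None [:- \<beta> i, 1:]) = (\<Sum>i=0..r. fe k s i)"
      by (simp add: ord_at_linear)
    thus ?thesis using assms(2) True by (simp add: D_def pt_last db_split ord_at_def)
  next
    case False
    hence i: "i \<in> {0..r}" using that by simp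
    hence "D (pt i) = - fe k s i + ord_at (Some (\<beta> i)) p"
      using sum_if_inj[OF inj_\<beta> i finite_atLeastAtMost, of "\<lambda>i. - fe k s i"]
      by (simp only: D_def pt_le some atLeastAtMost_iff)
    thus ?thesis by (simp add: ord_at_def)
  qed
  show "D (Some b) \<ge> 0" if "b \<notin> \<beta> ` {0..r}"
  proof -
    have "(\<Sum>i=0..r. if \<beta> i = b then - fe k s i else 0) = 0" using that by (intro sum.neutral) auto
    thus ?thesis unfolding D_def some by (simp add: ord_at_def)
  qed
qed

section \<open>Closure of Riemann-Roch spaces under sums, scalars and conjugation\<close>

lemma RR_D:
  "z \<in> RR_space \<iota> x P s \<Longrightarrow> is_place \<iota> v \<Longrightarrow> z = 0 \<or> v z \<ge> (if lies_over \<iota> x v P then - s else 0)"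
  by (auto simp: RR_space_def)

lemma RR_I:
  "(\<And>v. is_place \<iota> v \<Longrightarrow> z = 0 \<or> v z \<ge> (if lies_over \<iota> x v P then - s else 0)) \<Longrightarrow> z \<in> RR_space \<iota> x P s"
  unfolding RR_space_def by blast

lemma kummer_placeI: "is_place \<iota> v \<Longrightarrow> kummer_place \<iota> x y m r \<alpha> lam v"
  by unfold_locales

lemma RR_sum:
  assumes "\<And>i. i \<in> A \<Longrightarrow> g i \<in> RR_space \<iota> x P s"
  shows "sum g A \<in> RR_space \<iota> x P s"
proof (rule RR_I)
  fix v assume v: "is_place \<iota> v"
  interpret kummer_place \<iota> x y m r \<alpha> lam v by (rule kummer_placeI[OF v])
  have "vge (sum g A) (if lies_over \<iota> x v P then - s else 0)"
    using RR_D[OF assms v] by (intro vge_sum) (simp only: vge_def)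
  thus "sum g A = 0 \<or> v (sum g A) \<ge> (if lies_over \<iota> x v P then - s else 0)" by (simp only: vge_def)
qed

lemma RR_scale:
  assumes "z \<in> RR_space \<iota> x P s"
  shows "\<iota> c * z \<in> RR_space \<iota> x P s"
proof (rule RR_I)
  fix v assume v: "is_place \<iota> v"
  interpret kummer_place \<iota> x y m r \<alpha> lam v by (rule kummer_placeI[OF v])
  have "vge (\<iota> c * z) (0 + (if lies_over \<iota> x v P then - s else 0))"
    using RR_D[OF assms v] by (intro vge_mult vge_const) (simp only: vge_def)
  thus "\<iota> c * z = 0 \<or> v (\<iota> c * z) \<ge> (if lies_over \<iota> x v P then - s else 0)" by (simp only: vge_def add_0)
qed

text \<open>Composing a place with \<sigma> gives a place over the same point, since \<sigma> is
  onto and fixes x and K. The bounds depend on the point alone, so they pass from z to \<sigma>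
  z.\<close>

lemma RR_conjugate:
  assumes \<sigma>: "unital_hom \<sigma>" "surj \<sigma>" "\<sigma> x = x" "\<And>c. \<sigma> (\<iota> c) = \<iota> c" and z: "z \<in> RR_space \<iota> x P s"
  shows "\<sigma> z \<in> RR_space \<iota> x P s"
proof (rule RR_I)
  fix v assume v: "is_place \<iota> v"
  interpret \<sigma>: unital_field_hom \<sigma> using \<sigma>(1) by (simp add: unital_field_hom_def)
  interpret kummer_place \<iota> x y m r \<alpha> lam v by (rule kummer_placeI[OF v])
  obtain t where t: "t \<noteq> 0" "v t = 1" using v unfolding is_place_def by blast
  obtain t' where t': "t = \<sigma> t'" using \<sigma>(2) by (rule surjE)
  have "is_place \<iota> (\<lambda>z. v (\<sigma> z))"
    unfolding is_place_def
  proof (intro conjI allI impI)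
    show "v (\<sigma> 0) = 0" using v by (simp add: is_place_def \<sigma>.hom_0)
    show "\<exists>t. t \<noteq> 0 \<and> v (\<sigma> t) = 1" using t unfolding t' by (intro exI[of _ t']) (auto simp: \<sigma>.hom_0)
  next
    fix a b :: 'f assume ab: "a \<noteq> 0" "b \<noteq> 0"
    thus "v (\<sigma> (a * b)) = v (\<sigma> a) + v (\<sigma> b)" by (simp add: \<sigma>.hom_mult v_mult \<sigma>.hom_eq_0_iff)
    assume "a + b \<noteq> 0"
    hence "\<sigma> a + \<sigma> b \<noteq> 0" by (simp add: \<sigma>.hom_eq_0_iff flip: \<sigma>.hom_add)
    thus "min (v (\<sigma> a)) (v (\<sigma> b)) \<le> v (\<sigma> (a + b))"
      unfolding \<sigma>.hom_add using ab by (intro v_add) (simp_all add: \<sigma>.hom_eq_0_iff)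
  next
    fix c :: 'k assume "c \<noteq> 0" thus "v (\<sigma> (\<iota> c)) = 0" using v_const \<sigma>(4) by simp
  qed
  from RR_D[OF z this] have "z = 0 \<or> v (\<sigma> z) \<ge> (if lies_over \<iota> x (\<lambda>z. v (\<sigma> z)) P then - s else 0)" .
  moreover have "lies_over \<iota> x (\<lambda>z. v (\<sigma> z)) P = lies_over \<iota> x v P"
    by (simp add: lies_over_def \<sigma>.hom_diff \<sigma> split: option.split)
  ultimately show "\<sigma> z = 0 \<or> v (\<sigma> z) \<ge> (if lies_over \<iota> x v P then - s else 0)"
    using \<sigma>.hom_0 by auto
qed

text \<open>The component \<open>a l * y ^ l\<close> is a linear combination of the Galois conjugates of \<open>z\<close>.\<close>

lemma component_in_RR:
  assumes a: "\<And>k. a k \<in> Kx" and z: "(\<Sum>k<m. a k * y ^ k) \<in> RR_space \<iota> x P s" and l: "l < m"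
  shows "a l * y ^ l \<in> RR_space \<iota> x P s"
proof -
  have conj: "(\<Sum>k<m. a k * (\<iota> (z0 ^ k) * y ^ k)) \<in> RR_space \<iota> x P s" if z0: "z0 \<in> roots_unity m" for z0
  proof -
    obtain \<sigma> where \<sigma>: "unital_hom \<sigma>" "surj \<sigma>" "\<sigma> x = x" "\<sigma> y = \<iota> z0 * y" "\<And>c. \<sigma> (\<iota> c) = \<iota> c"
      using galois_conjugation[OF z0] by blast
    interpret \<sigma>: unital_hom \<sigma> by (rule \<sigma>(1))
    have "\<sigma> (\<Sum>k<m. a k * y ^ k) = (\<Sum>k<m. a k * (\<iota> (z0 ^ k) * y ^ k))"
      unfolding \<sigma>.hom_sum \<sigma>.hom_mult \<sigma>.hom_power \<sigma>(4) fixes_Kx[OF \<sigma>(1,3,5) a]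
      by (simp add: power_mult_distrib \<iota>.hom_power)
    thus ?thesis using RR_conjugate[OF \<sigma>(1,2,3,5) z] by simp
  qed
  \<comment> \<open>The exponent m - l stands for -l. Summing over all roots kills every k other
    than l and leaves a factor m, which is invertible in K.\<close>
  define w where "w = (\<Sum>z0\<in>roots_unity m. \<iota> (z0 ^ (m - l)) * (\<Sum>k<m. a k * (\<iota> (z0 ^ k) * y ^ k)))"
  have w: "w \<in> RR_space \<iota> x P s" unfolding w_def by (intro RR_sum RR_scale conj)
  have dvd: "m dvd m - l + k \<longleftrightarrow> k = l" if "k < m" for k
  proof
    assume "m dvd m - l + k"
    hence "int m dvd int m - int l + int k" using l by (metis int_dvd_int_iff of_nat_add of_nat_diff less_imp_le)
    hence "int m dvd (int m - int l + int k) - int m" by (intro dvd_diff) auto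
    hence "int k mod int m = int l mod int m" by (simp add: mod_eq_dvd_iff)
    thus "k = l" using that l by simp
  qed (use l in simp)
  have "w = (\<Sum>z0\<in>roots_unity m. \<Sum>k<m. a k * y ^ k * \<iota> (z0 ^ (m - l + k)))"
    unfolding w_def sum_distrib_left by (simp add: power_add \<iota>.hom_mult mult_ac)
  also have "\<dots> = (\<Sum>k<m. \<Sum>z0\<in>roots_unity m. a k * y ^ k * \<iota> (z0 ^ (m - l + k)))" by (rule sum.swap)
  also have "\<dots> = (\<Sum>k<m. a k * y ^ k * \<iota> (if k = l then of_nat m else 0))"
  proof (intro sum.cong refl)
    fix k assume "k \<in> {..<m}"
    hence "(if m dvd m - l + k then of_nat m else 0 :: 'k) = (if k = l then of_nat m else 0)" using dvd by simp
    thus "(\<Sum>z0\<in>roots_unity m. a k * y ^ k * \<iota> (z0 ^ (m - l + k))) = a k * y ^ k * \<iota> (if k = l then of_nat m else 0)"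
      unfolding sum_distrib_left[symmetric] \<iota>.hom_sum[symmetric] sum_powers_roots_unity[OF ac m_nz] by simp
  qed
  also have "\<dots> = (\<Sum>k<m. if k = l then a l * y ^ l * \<iota> (of_nat m) else 0)"
    by (intro sum.cong) (auto simp: \<iota>.hom_0)
  also have "\<dots> = a l * y ^ l * \<iota> (of_nat m)" using l by simp
  finally have "\<iota> (inverse (of_nat m)) * w = a l * y ^ l * (\<iota> (of_nat m * inverse (of_nat m)))"
    by (simp only: \<iota>.hom_mult mult_ac)
  hence "\<iota> (inverse (of_nat m)) * w = a l * y ^ l" using m_nz by (simp add: \<iota>.hom_1)
  thus ?thesis using RR_scale[OF w] by metis
qed

section \<open>Pole conditions on a single line \<open>K(x) y ^ k\<close>\<close>

lemma floor_exp_le: "int m * fe k s i \<le> int k * L i + (if i = u then s * gcd (int m) (L u) else 0)"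
proof -
  have "int m * (a div int m) \<le> a" for a
    using mult_div_mod_eq[of "int m" a] pos_mod_sign[of "int m" a] m_pos by linarith
  thus ?thesis unfolding floor_exp_def .
qed

lemma floor_exp_geI:
  assumes "int m * n \<le> int k * L i + (if i = u then s * gcd (int m) (L u) else 0)"
  shows "n \<le> fe k s i"
proof -
  have "n = (int m * n) div int m" using m_pos by simp
  also have "\<dots> \<le> fe k s i" unfolding floor_exp_def by (intro zdiv_mono1 assms) (use m_pos in simp)
  finally show ?thesis .
qed

text \<open>Sufficiency has to be checked at every place. All values are multiplied by m because the
  value of y is known only through that of y^m.\<close>

lemma term_in_RR:
  assumes s: "s \<ge> 0" and p: "p = 0 \<or> int (degree p) \<le> db k s"
  shows "y ^ k * gk k s * ev p \<in> RR_space \<iota> x (pt u) s"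
proof (rule RR_I, rule disjI2)
  fix v assume v: "is_place \<iota> v"
  interpret kummer_place \<iota> x y m r \<alpha> lam v by (rule kummer_placeI[OF v])
  let ?z = "y ^ k * gk k s * ev p"
  let ?bnd = "if lies_over \<iota> x v (pt u) then - s else 0"
  have bnd: "?bnd \<le> 0" using s by simp
  show "v ?z \<ge> ?bnd"
  proof (cases "p = 0")
    case True
    thus ?thesis using bnd v by (simp add: is_place_def)
  next
    case p0: False
    hence deg: "int (degree p) \<le> db k s" using p by simp
    have vgk: "v (gk k s) = (\<Sum>i=0..r. - fe k s i * v (x - \<iota> (\<beta> i)))"
      unfolding gk_def by (subst v_prod) (simp_all add: v_power_int del: right_minus_eq)
    have vz: "v ?z = int k * v y + v (gk k s) + v (ev p)"
      using p0 by (simp add: v_mult v_power)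
    show ?thesis
    proof (cases "\<exists>P. v (tp P) > 0")
      case True
      then obtain P where P: "v (tp P) > 0" by blast
      define e where "e = v (tp P)"
      define D where "D = (\<Sum>i=0..r. - fe k s i * ord_at P [:- \<beta> i, 1:]) + ord_at P p"
      have "v (x - \<iota> b) = e * ord_at P [:- b, 1:]" for b
        using v_ev[OF _ P, of "[:- b, 1:]"] unfolding ev_linear e_def by simp
      hence "v (gk k s) + v (ev p) = e * D"
        unfolding vgk v_ev[OF p0 P] D_def e_def by (simp add: sum_distrib_left distrib_left mult_ac)
      moreover have "int m * v y = e * ord_at P f" unfolding e_def by (rule v_y[OF P])
      ultimately have mvz: "int m * v ?z = e * (int k * ord_at P f + int m * D)"
        unfolding vz by (simp add: algebra_simps)
      have e0: "e > 0" using P by (simp add: e_def)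
      show ?thesis
      proof (cases P rule: point_cases)
        case (other b)
        hence "int k * ord_at P f + int m * D \<ge> 0"
          using ord_gk_poly(2)[OF p0 deg] by (simp add: ord_at_f_other D_def)
        hence "int m * v ?z \<ge> 0" unfolding mvz using e0 by simp
        hence "v ?z \<ge> 0" using m_pos by (simp add: zero_le_mult_iff)
        thus ?thesis using bnd by linarith
      next
        case (pt i)
        have "- fe k s i \<le> D" using ord_gk_poly(1)[OF p0 deg pt(1)] by (simp only: D_def pt(2))
        hence "int m * (- fe k s i) \<le> int m * D" by (intro mult_left_mono) simp_all
        hence ge: "int k * L i + int m * D \<ge> - (if i = u then s * gcd (int m) (L u) else 0)"
          using floor_exp_le[of k s i] by linarith
        have ordf: "ord_at P f = L i" unfolding pt(2) by (rule ord_at_pt_f[OF pt(1)])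
        show ?thesis
        proof (cases "i = u")
          case True
          \<comment> \<open>The exact ramification index enters here: it trades the summand s gcd(m,
            L u) of \<open>floor_exp\<close> for s itself.\<close>
          have eg: "e * gcd (int m) (L u) = int m"
            unfolding e_def ramification_index[OF P] ordf True by simp
          have "e * (- (s * gcd (int m) (L u))) = (e * gcd (int m) (L u)) * (- s)" by simp
          also have "\<dots> = int m * (- s)" by (simp only: eg)
          finally have "e * (- (s * gcd (int m) (L u))) = int m * (- s)" .
          moreover have "e * (- (s * gcd (int m) (L u))) \<le> int m * v ?z"
            unfolding mvz ordf using ge True e0 by (intro mult_left_mono) simp_all
          ultimately have "int m * (- s) \<le> int m * v ?z" by (simp only:)
          hence "- s \<le> v ?z" using m_pos by (simp only: mult_le_cancel_left_pos of_nat_0_less_iff)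
          moreover have "lies_over \<iota> x v (pt_ext \<alpha> \<alpha>0 r u)"
            unfolding lies_over_iff[OF v] using P pt(2) True by simp
          ultimately show ?thesis by simp
        next
          case False
          hence "int m * v ?z \<ge> 0" unfolding mvz ordf using ge e0 by simp
          hence "v ?z \<ge> 0" using m_pos by (simp add: zero_le_mult_iff)
          thus ?thesis using bnd by linarith
        qed
      qed
    next
      case False
      \<comment> \<open>A valuation over no point is handled rather than excluded: x is integral and
        every x - b is a unit, hence so is y, and the value in question is nonnegative.\<close>
      hence le: "v (tp P) \<le> 0" for P by (meson not_le)
      have vx: "vge x 0" using le[of None] by (simp add: loc_param_def v_inverse vge_def)
      have lin: "v (x - \<iota> b) = 0" for b
      proof -
        have "vge (x - \<iota> b) 0" by (intro vge_diff vx vge_const)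
        thus ?thesis using le[of "Some b"] by (simp add: loc_param_def vge_def del: right_minus_eq)
      qed
      have "int m * v y = v (\<Prod>i=1..r. (x - \<iota> (\<alpha> i)) ^ lam i)"
        unfolding y_power[symmetric] by (simp add: v_power)
      also have "\<dots> = 0" by (subst v_prod) (simp_all add: v_power lin del: right_minus_eq)
      finally have "v y = 0" using m_pos by simp
      moreover have "v (ev p) \<ge> 0" using vge_hom_eval[OF vx, of p] p0 by (simp add: vge_def)
      ultimately have "v ?z \<ge> 0" unfolding vz vgk lin by simp
      thus ?thesis using bnd by linarith
    qed
  qed
qed

text \<open>Necessity: one place over each point, taken from \<open>place_exists\<close>, is enough.
  \<open>lies_over_unique\<close> decides whether its bound is -s or 0, and integrality of the order
  of a = p/q sharpens the rational bound to a floor.\<close>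

lemma term_order_bound:
  assumes p: "p \<noteq> 0" and q: "q \<noteq> 0" and a: "a * ev q = ev p" and RR: "a * y ^ k \<in> RR_space \<iota> x (pt u) s"
  shows "i \<le> r + 1 \<Longrightarrow> ord_at (pt i) q \<le> ord_at (pt i) p + fe k s i"
    and "b \<notin> \<beta> ` {0..r} \<Longrightarrow> ord_at (Some b) q \<le> ord_at (Some b) p"
proof -
  have a0: "a \<noteq> 0" using a p by auto
  have main: "\<exists>e>0. e = int m div gcd (int m) (ord_at P f) \<and>
      e * (int k * ord_at P f + int m * (ord_at P p - ord_at P q)) \<ge> int m * (if P = pt u then - s else 0)" for P
  proof -
    obtain v where v: "is_place \<iota> v" "v (tp P) > 0" using place_exists by blast
    interpret kummer_place \<iota> x y m r \<alpha> lam v by (rule kummer_placeI[OF v(1)])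
    have "lies_over \<iota> x v (pt_ext \<alpha> \<alpha>0 r u) \<longleftrightarrow> P = pt u"
      unfolding lies_over_iff[OF v(1)] using v(2) lies_over_unique by auto
    hence ge: "v (a * y ^ k) \<ge> (if P = pt u then - s else 0)"
      using RR_D[OF RR v(1)] a0 by simp
    have "v a + v (ev q) = v (ev p)" using a0 q by (simp add: v_mult flip: a)
    hence va: "v a = v (tp P) * (ord_at P p - ord_at P q)"
      unfolding v_ev[OF p v(2)] v_ev[OF q v(2)] by (simp add: algebra_simps)
    have "int m * v (a * y ^ k) = int k * (int m * v y) + int m * v a"
      using a0 by (simp add: v_mult v_power algebra_simps)
    also have "\<dots> = v (tp P) * (int k * ord_at P f + int m * (ord_at P p - ord_at P q))"
      unfolding v_y[OF v(2)] va by (simp add: algebra_simps)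
    finally have "v (tp P) * (int k * ord_at P f + int m * (ord_at P p - ord_at P q)) = int m * v (a * y ^ k)" ..
    moreover have "int m * v (a * y ^ k) \<ge> int m * (if P = pt u then - s else 0)"
      using ge by (intro mult_left_mono) simp_all
    ultimately show ?thesis using v(2) ramification_index[OF v(2)]
      by (intro exI[of _ "v (tp P)"]) simp
  qed
  show "ord_at (pt i) q \<le> ord_at (pt i) p + fe k s i" if i: "i \<le> r + 1"
  proof -
    let ?o = "ord_at (pt i) p - ord_at (pt i) q"
    obtain e where e: "e > 0" "e = int m div gcd (int m) (L i)"
      "e * (int k * L i + int m * ?o) \<ge> int m * (if pt i = pt u then - s else 0)"
      using main[of "pt i"] unfolding ord_at_pt_f[OF i] by blast
    have "int m * (- ?o) \<le> int k * L i + (if i = u then s * gcd (int m) (L u) else 0)"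
    proof (cases "i = u")
      case True
      have eg: "e * gcd (int m) (L u) = int m" unfolding e(2) True by simp
      have "e * (- (s * gcd (int m) (L u))) = (e * gcd (int m) (L u)) * (- s)" by simp
      also have "\<dots> = int m * (- s)" by (simp only: eg)
      also have "\<dots> \<le> e * (int k * L i + int m * ?o)" using e(3) unfolding True by (simp only: refl if_True)
      finally have "e * (- (s * gcd (int m) (L u))) \<le> e * (int k * L i + int m * ?o)" .
      hence "- (s * gcd (int m) (L u)) \<le> int k * L i + int m * ?o" using e(1) by (simp only: mult_le_cancel_left_pos)
      thus ?thesis using True by (simp add: algebra_simps)
    next
      case False
      have "pt i \<noteq> pt u"
      proof
        assume eq: "pt i = pt u"
        consider "i = Suc r" | "u = Suc r" | "i \<le> r" "u \<le> r" using i u by linarith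
        thus False
        proof cases
          case 1 thus ?thesis using eq False u pt_le[of u] by (simp add: pt_last)
        next
          case 2 thus ?thesis using eq False i pt_le[of i] by (simp add: pt_last)
        next
          case 3 thus ?thesis using eq False inj_onD[OF inj_\<beta>, of i u] by (simp add: pt_le)
        qed
      qed
      hence "0 \<le> e * (int k * L i + int m * ?o)" using e(3) by simp
      hence "0 \<le> int k * L i + int m * ?o" using e(1) by (simp add: zero_le_mult_iff)
      thus ?thesis using False by (simp add: algebra_simps)
    qed
    from floor_exp_geI[OF this] show ?thesis by simp
  qed
  show "ord_at (Some b) q \<le> ord_at (Some b) p" if b: "b \<notin> \<beta> ` {0..r}"
  proof -
    have ne: "Some b \<noteq> pt u"
    proof
      assume eq: "Some b = pt u"
      hence "u \<noteq> Suc r" by (auto simp: pt_last)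
      hence "u \<le> r" using u by simp
      thus False using eq b by (simp add: pt_le)
    qed
    obtain e where "e > 0" "e * (int m * (ord_at (Some b) p - ord_at (Some b) q)) \<ge> 0"
      using main[of "Some b"] ne unfolding ord_at_f_other[OF b] by auto
    thus ?thesis using m_pos by (simp add: zero_le_mult_iff)
  qed
qed

text \<open>The quotient of a by \<open>gk k s\<close> has no pole at a finite point, hence is a
  polynomial by \<open>dvd_of_order_le\<close>; the order at infinity bounds its degree.\<close>

lemma term_form:
  assumes a: "a \<in> Kx" and RR: "a * y ^ k \<in> RR_space \<iota> x (pt u) s"
  shows "\<exists>p. a = gk k s * ev p \<and> (p = 0 \<or> int (degree p) \<le> db k s)"
proof (cases "a = 0")
  case True
  thus ?thesis by (intro exI[of _ 0]) simp
next
  case a0: False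
  obtain p q where q: "q \<noteq> 0" and eq: "a * ev q = ev p" using a unfolding Kx_def by blast
  have "ev p \<noteq> 0" unfolding eq[symmetric] using a0 q by simp
  hence p: "p \<noteq> 0" by auto
  note bound = term_order_bound[OF p q eq RR]
  \<comment> \<open>A and B are numerator and denominator of the inverse of \<open>gk k s\<close>,
    separated by the sign of the exponents so that orders and degrees are compared among
    polynomials.\<close>
  define A where "A = (\<Prod>i=0..r. [:- \<beta> i, 1:] ^ nat (fe k s i))"
  define B where "B = (\<Prod>i=0..r. [:- \<beta> i, 1:] ^ nat (- fe k s i))"
  have A0: "A \<noteq> 0" and B0: "B \<noteq> 0" by (auto simp: A_def B_def)
  have ordA: "order (\<beta> i) A = nat (fe k s i)" "order (\<beta> i) B = nat (- fe k s i)" if "i \<in> {0..r}" for i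
    unfolding A_def B_def order_prod_linear_powers[OF finite_atLeastAtMost]
    using that by (intro sum_if_inj inj_\<beta> finite_atLeastAtMost; simp)+
  have "q * B dvd p * A"
  proof (rule dvd_of_order_le[OF ac])
    show "p * A \<noteq> 0" "q * B \<noteq> 0" using p q A0 B0 by simp_all
    fix b
    have o: "order b (p * A) = order b p + order b A" "order b (q * B) = order b q + order b B"
      using p q A0 B0 by (simp_all add: order_mult)
    show "order b (q * B) \<le> order b (p * A)"
    proof (cases "b \<in> \<beta> ` {0..r}")
      case True
      then obtain i where i: "i \<in> {0..r}" "b = \<beta> i" by blast
      have "int (order b q) \<le> int (order b p) + fe k s i"
        using bound(1)[of i] i by (simp add: pt_le ord_at_def)
      thus ?thesis unfolding o unfolding i(2) ordA[OF i(1)] by linarith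
    next
      case False
      have "order b B = 0" unfolding B_def order_prod_linear_powers[OF finite_atLeastAtMost]
        using False by (intro sum.neutral) auto
      moreover have "order b q \<le> order b p" using bound(2)[OF False] by (simp add: ord_at_def)
      ultimately show ?thesis unfolding o by simp
    qed
  qed
  then obtain p' where p': "p * A = q * B * p'" by blast
  have "p * A \<noteq> 0" using p A0 by simp
  hence p'0: "p' \<noteq> 0" unfolding p' by auto
  have "degree p + degree A = degree q + degree B + degree p'"
    using arg_cong[OF p', of degree] p q A0 B0 p'0 by (simp add: degree_mult_eq)
  hence "int (degree p) + (\<Sum>i=0..r. int (nat (fe k s i)))
       = int (degree q) + (\<Sum>i=0..r. int (nat (- fe k s i))) + int (degree p')"
    unfolding A_def B_def degree_prod_linear_powers of_nat_sum[symmetric] of_nat_add[symmetric] by simp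
  moreover have "(\<Sum>i=0..r. int (nat (fe k s i))) - (\<Sum>i=0..r. int (nat (- fe k s i))) = (\<Sum>i=0..r. fe k s i)"
    unfolding sum_subtractf[symmetric] by (intro sum.cong) auto
  moreover have "int (degree p) - int (degree q) \<le> fe k s (Suc r)"
    using bound(1)[of "Suc r"] by (simp add: pt_last ord_at_def)
  ultimately have deg: "int (degree p') \<le> db k s" unfolding db_split by linarith
  have fac: "ev A = (\<Prod>i=0..r. (x - \<iota> (\<beta> i)) ^ nat (fe k s i))" "ev B = (\<Prod>i=0..r. (x - \<iota> (\<beta> i)) ^ nat (- fe k s i))"
    unfolding A_def B_def ev.hom_prod ev.hom_power ev_linear by simp_all
  have gA: "gk k s * ev A = ev B"
    unfolding gk_def fac prod.distrib[symmetric]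
    by (intro prod.cong refl) (simp add: power_int_def power_inverse del: right_minus_eq)
  have "ev q * ev A * a = a * ev q * ev A" by (simp only: mult_ac)
  also have "\<dots> = ev q * ev B * ev p'"
    unfolding eq using arg_cong[OF p', of ev] by (simp only: ev.hom_mult)
  also have "\<dots> = ev q * ev A * (gk k s * ev p')" unfolding gA[symmetric] by (simp only: mult_ac)
  finally have "ev q * ev A * a = ev q * ev A * (gk k s * ev p')" .
  hence "a = gk k s * ev p'" using q A0 by simp
  thus ?thesis using deg by blast
qed

lemma ev_as_sum:
  assumes "p = 0 \<or> int (degree p) \<le> n"
  shows "ev p = (\<Sum>j<nat (n + 1). \<iota> (coeff p j) * x ^ j)"
proof (cases "p = 0")
  case False
  hence "degree p < nat (n + 1)" using assms by linarith
  thus ?thesis by (rule \<iota>.hom_eval_as_sum)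
qed (simp add: \<iota>.hom_0)

text \<open>The elements y^k \<open>gk k s\<close> x^j with k < m and j at most
  \<open>db k s\<close> form a basis: \<open>component_in_RR\<close> and \<open>term_form\<close>
  give spanning, \<open>term_in_RR\<close> gives membership, and \<open>lin_indep\<close> gives
  independence.\<close>

lemma ell_formula:
  assumes s: "s \<ge> 0"
  shows "ell \<iota> x (pt u) s = (\<Sum>k<m. nat (db k s + 1))"
proof -
  interpret vs: vector_space "\<lambda>c z. \<iota> c * z"
    by unfold_locales (simp_all add: \<iota>.hom_add \<iota>.hom_mult \<iota>.hom_1 algebra_simps)
  \<comment> \<open>The added 1 accounts for the constant term; for a negative bound
    \<open>nat\<close> makes the set empty.\<close>
  define J where "J k = {..<nat (db k s + 1)}" for k
  define I where "I = (SIGMA k:{..<m}. J k)"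
  define b where "b = (\<lambda>(k, j). y ^ k * gk k s * x ^ j)"
  have expand: "(\<Sum>i\<in>I. \<iota> (c i) * b i) = (\<Sum>k<m. (gk k s * (\<Sum>j\<in>J k. \<iota> (c (k, j)) * x ^ j)) * y ^ k)" for c
  proof -
    have "(\<Sum>i\<in>I. \<iota> (c i) * b i) = (\<Sum>k<m. \<Sum>j\<in>J k. \<iota> (c (k, j)) * b (k, j))"
      unfolding I_def by (subst sum.Sigma) (auto simp: J_def intro!: sum.cong)
    also have "\<dots> = (\<Sum>k<m. (gk k s * (\<Sum>j\<in>J k. \<iota> (c (k, j)) * x ^ j)) * y ^ k)"
      unfolding b_def sum_distrib_left sum_distrib_right by (intro sum.cong refl) (simp add: mult_ac)
    finally show ?thesis .
  qed
  define pol where "pol c k = (\<Sum>j\<in>J k. monom (c (k, j)) j)" for c :: "nat \<times> nat \<Rightarrow> 'k" and k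
  have ev_pol: "ev (pol c k) = (\<Sum>j\<in>J k. \<iota> (c (k, j)) * x ^ j)" for c k
    unfolding pol_def ev.hom_sum \<iota>.hom_eval_monom ..
  have coeff_pol: "coeff (pol c k) j = c (k, j)" if "j \<in> J k" for c k j
    using that by (simp add: pol_def coeff_sum J_def)
  have deg_pol: "pol c k = 0 \<or> int (degree (pol c k)) \<le> db k s" for c k
  proof (cases "J k = {}")
    case False
    hence "nat (db k s + 1) > 0" by (auto simp: J_def)
    moreover have "degree (pol c k) \<le> nat (db k s + 1) - 1"
      unfolding pol_def J_def by (intro degree_sum_le) (auto intro: order_trans[OF degree_monom_le])
    ultimately show ?thesis by linarith
  qed (simp add: pol_def)
  have "vs.dim (RR_space \<iota> x (pt u) s) = card I"
  proof (rule vs.dim_eq_card_family)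
    show "finite I" by (simp add: I_def J_def)
  next
    fix c i assume 0: "(\<Sum>i\<in>I. \<iota> (c i) * b i) = 0" and i: "i \<in> I"
    obtain k j where kj: "i = (k, j)" "k < m" "j \<in> J k" using i by (auto simp: I_def)
    have sum0: "(\<Sum>k<m. (gk k s * ev (pol c k)) * y ^ k) = 0" using 0 unfolding expand ev_pol .
    have "gk k s * ev (pol c k) = 0"
      by (rule lin_indep[of "\<lambda>k. gk k s * ev (pol c k)", OF _ sum0 kj(2)]) (intro Kx_mult gk_Kx Kx_ev)
    hence "pol c k = 0" by simp
    thus "c i = 0" using coeff_pol[OF kj(3), of c] kj(1) by simp
  next
    show "RR_space \<iota> x (pt u) s = {\<Sum>i\<in>I. \<iota> (c i) * b i | c. True}"
    proof (intro equalityI subsetI)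
      fix z assume z: "z \<in> RR_space \<iota> x (pt u) s"
      obtain a where a: "\<And>k. a k \<in> Kx" "z = (\<Sum>k<m. a k * y ^ k)" using decomposition by blast
      have "\<exists>p. a k = gk k s * ev p \<and> (p = 0 \<or> int (degree p) \<le> db k s)" if "k < m" for k
        using term_form[OF a(1) component_in_RR[OF a(1) z[unfolded a(2)] that]] .
      then obtain p where p: "\<And>k. k < m \<Longrightarrow> a k = gk k s * ev (p k)"
        "\<And>k. k < m \<Longrightarrow> p k = 0 \<or> int (degree (p k)) \<le> db k s" by metis
      have "z = (\<Sum>k<m. (gk k s * (\<Sum>j\<in>J k. \<iota> (coeff (p k) j) * x ^ j)) * y ^ k)"
        unfolding a(2) J_def using p ev_as_sum[OF p(2)] by (intro sum.cong refl) simp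
      also have "\<dots> = (\<Sum>i\<in>I. \<iota> ((\<lambda>(k, j). coeff (p k) j) i) * b i)" unfolding expand by simp
      finally show "z \<in> {\<Sum>i\<in>I. \<iota> (c i) * b i | c. True}" by blast
    next
      fix z assume "z \<in> {\<Sum>i\<in>I. \<iota> (c i) * b i | c. True}"
      then obtain c where "z = (\<Sum>i\<in>I. \<iota> (c i) * b i)" by blast
      hence "z = (\<Sum>k<m. y ^ k * gk k s * ev (pol c k))" unfolding expand ev_pol by (simp add: mult_ac)
      thus "z \<in> RR_space \<iota> x (pt u) s" using term_in_RR[OF s deg_pol] by (simp add: RR_sum)
    qed
  qed
  also have "card I = (\<Sum>k<m. nat (db k s + 1))" by (simp add: I_def J_def)
  finally show ?thesis by (simp add: ell_def)
qed

end

theorem mainTheorem4: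
  fixes \<iota> :: "'k::field \<Rightarrow> 'f::field"
    and x y :: 'f and m r :: nat and \<alpha> :: "nat \<Rightarrow> 'k" and lam :: "nat \<Rightarrow> nat"
    and \<alpha>0 :: 'k and u :: nat and s :: int
  assumes "alg_closed TYPE('k)"
    and "m \<ge> 2" and "of_nat m \<noteq> (0::'k)"
    and "\<forall>i\<in>{1..r}. 0 < lam i \<and> lam i < m"
    and "inj_on \<alpha> {1..r}"
    and "\<forall>d. d > 1 \<longrightarrow> d dvd m \<longrightarrow>
           \<not> (\<exists>p q :: 'k poly. q \<noteq> 0 \<and> (\<Prod>i=1..r. [:- \<alpha> i, 1:] ^ lam i) * q ^ d = p ^ d)"
    and "field_hom \<iota>" and "transcendental_over \<iota> x"
    and "y ^ m = (\<Prod>i=1..r. (x - \<iota> (\<alpha> i)) ^ lam i)"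
    and "generated_by \<iota> x y"
    and "\<alpha>0 \<notin> \<alpha> ` {1..r}"
    and "u \<le> r + 1" and "s \<ge> 1"
  shows "int (ell \<iota> x (pt_ext \<alpha> \<alpha>0 r u) s) - int (ell \<iota> x (pt_ext \<alpha> \<alpha>0 r u) (s - 1)) =
         int (card {j \<in> {0..<gcd (int m) (lam_ext lam r u)}.
            (\<Sum>i=0..r. frac (real_of_int ((t_u m (lam_ext lam r u) s
                                  + j * m_u m (lam_ext lam r u)) * lam_ext lam r i) / real m))
              \<le> 1 + real_of_int \<lfloor>real_of_int (s - 1) / real_of_int (m_u m (lam_ext lam r u))\<rfloor>})"
proof -
  interpret kummer_point \<iota> x y m r \<alpha> lam \<alpha>0 u
    by unfold_locales (fact assms)+
  \<comment> \<open>\<open>ell_formula\<close> is available for nonnegative multiples of the fibre,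
    and s >= 1 brings s - 1 into its range.\<close>
  have "s \<ge> 0" "s - 1 \<ge> 0" using assms(13) by simp_all
  thus ?thesis
    unfolding ell_formula[OF \<open>s \<ge> 0\<close>] ell_formula[OF \<open>s - 1 \<ge> 0\<close>] of_nat_sum
    by (intro deg_bound_count[OF m_pos u L_sum])
qed

end
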